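(* If $EZ<\infty$, then for integers $0\le x<R$, as $R-x\to\infty$, $$P_x[\sigma_0<\sigma_{[R,\infty)}]\sim P_x[T<\sigma_{[R,\infty)}]\sim\frac{f_r(R)-f_r(x)}{f_r(R)}\le\frac{f_r(R-x)}{f_r(R)},$$ where $\sim$ means that the ratio of the two sides tends to $1$.
   Context: $X,X_1,X_2,\ldots$ are i.i.d. $\mathbb{Z}$-valued random variables and $S_n=S_0+X_1+\cdots+X_n$ is the associated random walk, assumed recurrent and irreducible as a Markov chain on $\mathbb{Z}$. $P_x$ denotes probability when $S_0=x$. For $B\subset\mathbb{R}$ with $B\cap\mathbb{Z}\ne\emptyset$, $\sigma_B=\inf\{n\ge1:S_n\in B\}$; $\sigma_y=\sigma_{\{y\}}$; $T=\sigma_{(-\infty,0]}$. $Z=S_{\sigma_{[S_0+1,\infty)}}-S_0$ is the first strictly ascending ladder height. $f_r(x)=V_{\rm ds}(x-1)$ for integers $x\ge1$, where $V_{\rm ds}(x)=1+\sum_{k=1}^\infty P[\zeta_1+\cdots+\zeta_k\le x]$, $x=0,1,2,\ldots$, with $\zeta_i$ i.i.d. copies of the weak descending ladder height $S_0-S_{\sigma_{(-\infty,S_0]}}$; and $f_r(x)=P[Z>-x]$ for integers $x\le0$ (so $f_r(0)=1$). *)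

theory Defs
  imports "HOL-Probability.Probability"
begin

definition walk :: "(nat \<Rightarrow> 'a \<Rightarrow> int) \<Rightarrow> int \<Rightarrow> 'a \<Rightarrow> nat \<Rightarrow> int" where
  "walk X x \<omega> n = x + (\<Sum>i=1..n. X i \<omega>)"

definition iid_steps :: "'a measure \<Rightarrow> (nat \<Rightarrow> 'a \<Rightarrow> int) \<Rightarrow> bool" where
  "iid_steps M X \<longleftrightarrow>
     prob_space.indep_vars M (\<lambda>_. count_space UNIV) X {1..} \<and>
     (\<forall>n\<ge>1. distr M (count_space UNIV) (X n) = distr M (count_space UNIV) (X 1))"

(* Time 0 does not count; the value is infinity if B is never hit. *)
definition hitting_time :: "int set \<Rightarrow> (nat \<Rightarrow> int) \<Rightarrow> enat" where
  "hitting_time B s = (INF n\<in>{n. 1 \<le> n \<and> s n \<in> B}. enat n)"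

definition irreducible_walk :: "'a measure \<Rightarrow> (nat \<Rightarrow> 'a \<Rightarrow> int) \<Rightarrow> bool" where
  "irreducible_walk M X \<longleftrightarrow> (\<forall>x y. \<exists>n. \<P>(\<omega> in M. walk X x \<omega> n = y) > 0)"

definition recurrent_walk :: "'a measure \<Rightarrow> (nat \<Rightarrow> 'a \<Rightarrow> int) \<Rightarrow> bool" where
  "recurrent_walk M X \<longleftrightarrow> (\<forall>x. \<P>(\<omega> in M. hitting_time {x} (walk X x \<omega>) < \<infinity>) = 1)"

(* The value at time infinity is arbitrary: for a recurrent irreducible walk the ladder
   times below are almost surely finite. *)
definition value_at :: "(nat \<Rightarrow> int) \<Rightarrow> enat \<Rightarrow> int" where
  "value_at s t = (case t of enat n \<Rightarrow> s n | \<infinity> \<Rightarrow> s 0)"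

(* The ladder heights are increments relative to the starting point, so the walk may be
   started at 0. *)
definition strict_ascending_height :: "(nat \<Rightarrow> 'a \<Rightarrow> int) \<Rightarrow> 'a \<Rightarrow> int" where
  "strict_ascending_height X \<omega> =
     (let s = walk X 0 \<omega> in value_at s (hitting_time {s 0 + 1..} s) - s 0)"

definition weak_descending_height :: "(nat \<Rightarrow> 'a \<Rightarrow> int) \<Rightarrow> 'a \<Rightarrow> int" where
  "weak_descending_height X \<omega> =
     (let s = walk X 0 \<omega> in s 0 - value_at s (hitting_time {..s 0} s))"

(* The i.i.d. copies of the weak descending ladder height are the coordinates of the
   product of k copies of its law; the summation index is k - 1. *)
definition V_ds :: "'a measure \<Rightarrow> (nat \<Rightarrow> 'a \<Rightarrow> int) \<Rightarrow> int \<Rightarrow> real" where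
  "V_ds M X x =
     1 + (\<Sum>k. \<P>(\<zeta> in \<Pi>\<^sub>M i\<in>{1..Suc k}. distr M (count_space UNIV) (weak_descending_height X).
                (\<Sum>i=1..Suc k. \<zeta> i) \<le> x))"

definition f_r :: "'a measure \<Rightarrow> (nat \<Rightarrow> 'a \<Rightarrow> int) \<Rightarrow> int \<Rightarrow> real" where
  "f_r M X x =
     (if 1 \<le> x then V_ds M X (x - 1) else \<P>(\<omega> in M. strict_ascending_height X \<omega> > - x))"

(* Pairs (x, R) with 0 \<le> x < R and R - x \<rightarrow> \<infinity>: convergence along this filter is uniform
   over all such pairs with R - x large. *)
definition gap_at_top :: "(int \<times> int) filter" where
  "gap_at_top =
     inf (filtercomap (\<lambda>(x, R). R - x) at_top) (principal {(x, R). 0 \<le> x \<and> x < R})"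

end

theory Submission
  imports Defs
begin

text \<open>The function \<open>f = f\<^sub>r\<close> is harmonic for the walk killed on entering \<open>(-\<infinity>, 0]\<close>, so stopping at the
  exit from \<open>(0, R)\<close> gives \<open>f R * P\<^sub>x[T < \<sigma>\<^sub>R] = f R - f x + D\<close>, where \<open>D\<close> is the expectation of
  \<open>f - f R\<close> at the entrance to \<open>[R, \<infinity>)\<close> on the event that this happens before \<open>T\<close>. The point is that
  \<open>D\<close> is small compared with \<open>f R - f x\<close>, uniformly in \<open>x\<close>. The increments \<open>w n = f n - f (n - 1)\<close> are
  superharmonic for the killed walk. If \<open>f m \<le> 8 f n\<close> with \<open>n < m\<close>, then harmonicity of \<open>f\<close> and
  \<open>E Z < \<infinity>\<close> force the walk from \<open>n\<close> to enter \<open>[m, \<infinity>)\<close> near \<open>m\<close> before \<open>T\<close> with a probability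
  bounded below, whence \<open>w m \<le> C w n\<close>. Together with subadditivity this yields
  \<open>f (R + k) - f R \<le> C k (f R - f x) / (R - x)\<close> for all \<open>k \<ge> 0\<close>, so \<open>D\<close> is at most a constant times
  \<open>f R - f x\<close> times the mean overshoot over \<open>R\<close> divided by \<open>R - x\<close>, which tends to \<open>0\<close> because
  \<open>E Z < \<infinity>\<close>. Replacing \<open>T\<close> by the hitting time of \<open>0\<close> costs a factor tending to \<open>1\<close>: from any point
  below \<open>0\<close> the walk enters \<open>[0, \<infinity>)\<close> with a tight overshoot, and then visits \<open>0\<close> before
  \<open>[R, \<infinity>)\<close> with probability close to \<open>1\<close>.\<close>

section \<open>Exit distributions as sums over finite paths\<close>

text \<open>Splitting off the head of a list is what turns sums over paths into first-step
  analysis.\<close>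

lemma nn_integral_count_space_list:
  fixes g :: "'a list \<Rightarrow> ennreal"
  shows "(\<integral>\<^sup>+ as. g as \<partial>count_space UNIV) =
    g [] + (\<integral>\<^sup>+ a. \<integral>\<^sup>+ as. g (a # as) \<partial>count_space UNIV \<partial>count_space UNIV)"
proof -
  have b: "bij_betw (\<lambda>(a, as). a # as) UNIV (- {[] :: 'a list})"
    by (auto simp: bij_betw_def inj_on_def image_iff) (metis list.exhaust)
  have "(\<integral>\<^sup>+ as. g as \<partial>count_space UNIV) =
      (\<integral>\<^sup>+ as. g as * indicator {[]} as + g as * indicator (- {[]}) as \<partial>count_space UNIV)"
    by (intro nn_integral_cong) (auto simp: indicator_def)
  also have "\<dots> = g [] + (\<integral>\<^sup>+ as. g as * indicator (- {[]}) as \<partial>count_space UNIV)"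
    by (subst nn_integral_add) (auto simp: nn_integral_count_space_indicator[symmetric] one_ennreal_def[symmetric])
  also have "(\<integral>\<^sup>+ as. g as * indicator (- {[]}) as \<partial>count_space UNIV) =
      (\<integral>\<^sup>+ as. g as \<partial>count_space (- {[]}))"
    by (simp add: nn_integral_count_space_indicator)
  also have "\<dots> = (\<integral>\<^sup>+ (a, as). g (a # as) \<partial>count_space UNIV)"
    by (subst nn_integral_bij_count_space[OF b, symmetric]) (auto intro!: nn_integral_cong)
  also have "\<dots> = (\<integral>\<^sup>+ a. \<integral>\<^sup>+ as. g (a # as) \<partial>count_space UNIV \<partial>count_space UNIV)"
    by (subst nn_integral_fst_count_space[symmetric]) simp
  finally show ?thesis .
qed

lemma nn_integral_count_space_rev:
  "(\<integral>\<^sup>+ as. g (rev as) \<partial>count_space UNIV) = (\<integral>\<^sup>+ as. g as \<partial>count_space UNIV)"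
  by (rule nn_integral_bij_count_space) (auto simp: bij_def inj_on_def surj_def intro: exI[of _ "rev _"])

text \<open>The starting point is not tested, matching hitting times that ignore time 0, and the
  list must stop at the step that leaves \<open>A\<close>; so each trajectory has at most one exit
  path among its initial segments.\<close>

fun exit_path :: "int set \<Rightarrow> int \<Rightarrow> int list \<Rightarrow> bool" where
  "exit_path A x [] \<longleftrightarrow> False"
| "exit_path A x (a # as) \<longleftrightarrow> (if x + a \<in> A then exit_path A (x + a) as else as = [])"

locale int_walk =
  fixes p :: "int pmf"
begin

definition step :: "(int \<Rightarrow> ennreal) \<Rightarrow> int \<Rightarrow> ennreal" where
  "step h x = (\<integral>\<^sup>+ a. h (x + a) \<partial>p)"

primrec weight :: "int list \<Rightarrow> ennreal" where
  "weight [] = 1"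
| "weight (a # as) = ennreal (pmf p a) * weight as"

text \<open>\<open>exit_mean A h x\<close> is the expectation of \<open>h\<close> at the position of the walk from \<open>x\<close> at the first
  time \<open>n \<ge> 1\<close> at which it is outside \<open>A\<close> (paths that never leave contribute \<open>0\<close>). A sum over finite
  lists of steps with their product weights avoids infinite product measures.\<close>

definition exit_mean :: "int set \<Rightarrow> (int \<Rightarrow> ennreal) \<Rightarrow> int \<Rightarrow> ennreal" where
  "exit_mean A h x =
     (\<integral>\<^sup>+ as. (if exit_path A x as then weight as * h (x + sum_list as) else 0) \<partial>count_space UNIV)"

text \<open>Counting only exits within \<open>n\<close> steps makes \<open>exit_mean\<close> the
  limit of an iteration started at 0; bounds on it then follow by induction on
  \<open>n\<close>.\<close>

primrec exit_upto :: "nat \<Rightarrow> int set \<Rightarrow> (int \<Rightarrow> ennreal) \<Rightarrow> int \<Rightarrow> ennreal" where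
  "exit_upto 0 A h = (\<lambda>x. 0)"
| "exit_upto (Suc n) A h = step (\<lambda>y. if y \<in> A then exit_upto n A h y else h y)"

section \<open>One-step averages and their iteration\<close>

lemma step_cong: "(\<And>y. g y = h y) \<Longrightarrow> step g x = step h x"
  by (simp add: step_def)

lemma step_mono: "(\<And>y. g y \<le> h y) \<Longrightarrow> step g x \<le> step h x"
  unfolding step_def by (intro nn_integral_mono) auto

lemma step_add: "step (\<lambda>y. g y + h y) x = step g x + step h x"
  unfolding step_def by (intro nn_integral_add) auto

lemma step_cmult: "step (\<lambda>y. c * h y) x = c * step h x"
  unfolding step_def by (intro nn_integral_cmult) auto

lemma step_const [simp]: "step (\<lambda>y. c) x = c"
  unfolding step_def by (simp add: measure_pmf.emeasure_space_1[simplified])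

lemma step_SUP:
  assumes "\<And>y. incseq (\<lambda>n. h n y)"
  shows "step (\<lambda>y. SUP n. h n y) x = (SUP n. step (h n) x)"
  unfolding step_def using assms
  by (intro nn_integral_monotone_convergence_SUP) (auto simp: incseq_def le_fun_def)

lemma step_ge: "ennreal (pmf p a) * h (x + a) \<le> step h x"
proof -
  have "ennreal (pmf p a) * h (x + a) = (\<integral>\<^sup>+ b. h (x + a) * indicator {a} b \<partial>p)"
    by (simp add: nn_integral_cmult_indicator emeasure_pmf_single mult.commute)
  also have "\<dots> \<le> step h x"
    unfolding step_def by (intro nn_integral_mono) (auto simp: indicator_def)
  finally show ?thesis .
qed

lemma step_shift: "step h (x + c) = step (\<lambda>y. h (y + c)) x"
  unfolding step_def by (simp add: algebra_simps)

lemma nn_integral_weight_Cons: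
  "(\<integral>\<^sup>+ a. \<integral>\<^sup>+ as. weight (a # as) * g a as \<partial>count_space UNIV \<partial>count_space UNIV) =
    (\<integral>\<^sup>+ a. \<integral>\<^sup>+ as. weight as * g a as \<partial>count_space UNIV \<partial>p)"
  by (simp add: nn_integral_measure_pmf mult.assoc nn_integral_cmult)

lemma exit_upto_eq:
  "exit_upto n A h x = (\<integral>\<^sup>+ as. (if exit_path A x as \<and> length as \<le> n
     then weight as * h (x + sum_list as) else 0) \<partial>count_space UNIV)"
proof (induction n arbitrary: x)
  case 0
  have "(if exit_path A x as \<and> length as \<le> 0 then weight as * h (x + sum_list as) else 0) = 0" for as
    by (cases as) auto
  then show ?case by simp
next
  case (Suc n)
  have *: "(\<integral>\<^sup>+ as. weight as * (if exit_path A x (a # as) \<and> length (a # as) \<le> Suc n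
      then h (x + sum_list (a # as)) else 0) \<partial>count_space UNIV) =
      (if x + a \<in> A then exit_upto n A h (x + a) else h (x + a))" (is "?L = _") for a
  proof (cases "x + a \<in> A")
    case True
    then show ?thesis unfolding Suc.IH
      by (auto intro!: nn_integral_cong simp: add.assoc)
  next
    case False
    then have "?L = (\<integral>\<^sup>+ as. weight as * h (x + a) * indicator {[]} as \<partial>count_space UNIV)"
      by (intro nn_integral_cong) (auto simp: indicator_def)
    with False show ?thesis
      by (simp add: nn_integral_count_space_indicator[symmetric] one_ennreal_def[symmetric])
  qed
  have "(\<integral>\<^sup>+ as. (if exit_path A x as \<and> length as \<le> Suc n
     then weight as * h (x + sum_list as) else 0) \<partial>count_space UNIV) =
     (\<integral>\<^sup>+ a. \<integral>\<^sup>+ as. weight (a # as) * (if exit_path A x (a # as) \<and> length (a # as) \<le> Suc n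
      then h (x + sum_list (a # as)) else 0) \<partial>count_space UNIV \<partial>count_space UNIV)"
    by (subst nn_integral_count_space_list) (auto intro!: nn_integral_cong)
  also have "\<dots> = exit_upto (Suc n) A h x"
    unfolding nn_integral_weight_Cons * by (simp add: step_def)
  finally show ?case by simp
qed

lemma exit_upto_le_Suc: "exit_upto n A h x \<le> exit_upto (Suc n) A h x"
  unfolding exit_upto_eq by (intro nn_integral_mono) auto

lemma incseq_exit_upto: "incseq (\<lambda>n. exit_upto n A h x)"
  by (intro incseq_SucI exit_upto_le_Suc)

lemma exit_mean_SUP: "exit_mean A h x = (SUP n. exit_upto n A h x)"
proof -
  let ?f = "\<lambda>n as. if exit_path A x as \<and> length as \<le> n then weight as * h (x + sum_list as) else 0"
  have "(SUP n. ?f n as) = (if exit_path A x as then weight as * h (x + sum_list as) else 0)" for as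
    by (intro antisym SUP_least SUP_upper2[of "length as"]) auto
  then have "exit_mean A h x = (\<integral>\<^sup>+ as. (SUP n. ?f n as) \<partial>count_space UNIV)"
    unfolding exit_mean_def by simp
  also have "\<dots> = (SUP n. exit_upto n A h x)"
    unfolding exit_upto_eq
    by (intro nn_integral_monotone_convergence_SUP) (auto simp: incseq_def le_fun_def)
  finally show ?thesis .
qed

lemma exit_upto_le_mean: "exit_upto n A h x \<le> exit_mean A h x"
  unfolding exit_mean_SUP by (intro SUP_upper) auto

lemma exit_mean_unfold:
  "exit_mean A h x = step (\<lambda>y. if y \<in> A then exit_mean A h y else h y) x"
proof -
  have "exit_mean A h x = (SUP n. exit_upto (Suc n) A h x)"
    unfolding exit_mean_SUP
    by (intro antisym SUP_mono) (auto intro: exit_upto_le_Suc simp del: exit_upto.simps)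
  also have "\<dots> = step (\<lambda>y. SUP n. if y \<in> A then exit_upto n A h y else h y) x"
    by (subst step_SUP) (auto simp: incseq_def intro: incseqD[OF incseq_exit_upto])
  also have "\<dots> = step (\<lambda>y. if y \<in> A then exit_mean A h y else h y) x"
    by (intro step_cong) (simp add: exit_mean_SUP)
  finally show ?thesis .
qed

text \<open>The iterates \<open>exit_upto\<close> start at 0 and stay below every supersolution of
  the first-step equation, so \<open>exit_mean\<close> is its least solution. Most upper bounds
  below come from exhibiting a supersolution.\<close>

lemma exit_mean_least:
  assumes "\<And>x. step (\<lambda>y. if y \<in> A then g y else h y) x \<le> g x"
  shows "exit_mean A h x \<le> g x"
proof -
  have "exit_upto n A h x \<le> g x" for n x
  proof (induction n arbitrary: x)
    case (Suc n)
    have "exit_upto (Suc n) A h x \<le> step (\<lambda>y. if y \<in> A then g y else h y) x"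
      using Suc by (auto intro!: step_mono)
    with assms show ?case by (meson order_trans)
  qed simp
  then show ?thesis unfolding exit_mean_SUP by (intro SUP_least)
qed

lemma exit_mean_mono:
  assumes "\<And>y. y \<notin> A \<Longrightarrow> g y \<le> h y"
  shows "exit_mean A g x \<le> exit_mean A h x"
  by (rule exit_mean_least, subst (2) exit_mean_unfold) (auto intro!: step_mono assms)

lemma exit_mean_cong:
  assumes "\<And>y. y \<notin> A \<Longrightarrow> g y = h y"
  shows "exit_mean A g x = exit_mean A h x"
  by (intro antisym exit_mean_mono) (auto simp: assms)

lemma exit_mean_add: "exit_mean A (\<lambda>y. g y + h y) x = exit_mean A g x + exit_mean A h x"
  unfolding exit_mean_def
  by (subst nn_integral_add[symmetric]) (auto intro!: nn_integral_cong simp: distrib_left)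

lemma exit_mean_cmult: "exit_mean A (\<lambda>y. c * h y) x = c * exit_mean A h x"
  unfolding exit_mean_def
  by (subst nn_integral_cmult[symmetric]) (auto intro!: nn_integral_cong simp: mult_ac)

lemma exit_mean_zero [simp]: "exit_mean A (\<lambda>y. 0) x = 0"
  unfolding exit_mean_def by (simp add: if_distrib cong: if_cong)

lemma exit_path_shift: "exit_path A (x + c) as = exit_path ((\<lambda>y. y + c) -` A) x as"
proof (induction as arbitrary: x)
  case (Cons a as)
  have "x + c + a = (x + a) + c" by simp
  then show ?case using Cons[of "x + a"] by (simp only: exit_path.simps vimage_eq)
qed simp

lemma exit_mean_shift:
  "exit_mean A h (x + c) = exit_mean ((\<lambda>y. y + c) -` A) (\<lambda>y. h (y + c)) x"
  unfolding exit_mean_def exit_path_shift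
  by (intro nn_integral_cong if_cong arg_cong[where f=h] arg_cong2[where f="(*)"]) auto

lemma exit_mean_SUP_fun:
  assumes "\<And>y. incseq (\<lambda>n. h n y)"
  shows "exit_mean A (\<lambda>y. SUP n. h n y) x = (SUP n. exit_mean A (h n) x)"
proof -
  have "(if exit_path A x as then weight as * (SUP n. h n (x + sum_list as)) else 0) =
      (SUP n. if exit_path A x as then weight as * h n (x + sum_list as) else 0)" for as
    by (auto simp: SUP_mult_left_ennreal)
  then show ?thesis
    unfolding exit_mean_def
    by (simp only:, intro nn_integral_monotone_convergence_SUP)
      (auto simp: incseq_def le_fun_def intro!: mult_left_mono incseqD[OF assms])
qed

text \<open>Optional stopping for a superharmonic function: \<open>step h\<close> is itself a
  supersolution. The bound is \<open>step h x\<close> rather than \<open>h x\<close>, as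
  \<open>x\<close> need not lie in \<open>A\<close>.\<close>

lemma exit_mean_step_le:
  assumes "\<And>y. y \<in> A \<Longrightarrow> step h y \<le> h y"
  shows "exit_mean A h x \<le> step h x"
  by (rule exit_mean_least) (auto intro!: step_mono assms)

text \<open>The walk leaves the smaller set first and, if it is then still in \<open>B\<close>,
  starts afresh. One direction is an induction over the number of steps, the other is minimality of
  \<open>exit_mean A\<close>.\<close>

lemma exit_mean_strong_Markov:
  assumes "A \<subseteq> B"
  shows "exit_mean B h x = exit_mean A (\<lambda>y. if y \<in> B then exit_mean B h y else h y) x" (is "_ = ?R x")
proof (rule antisym)
  let ?g = "\<lambda>y. if y \<in> B then exit_mean B h y else h y"
  have "exit_upto n B h x \<le> exit_mean A ?g x" for n
  proof (induction n arbitrary: x)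
    case (Suc n)
    have "exit_upto (Suc n) B h x \<le> step (\<lambda>y. if y \<in> A then exit_mean A ?g y else ?g y) x"
      using Suc assms exit_upto_le_mean by (auto intro!: step_mono)
    then show ?case by (subst exit_mean_unfold)
  qed simp
  then show "exit_mean B h x \<le> ?R x" unfolding exit_mean_SUP[of B h x] by (intro SUP_least)
  show "?R x \<le> exit_mean B h x"
    by (rule exit_mean_least, subst (3) exit_mean_unfold) (use assms in \<open>auto intro!: step_mono\<close>)
qed

text \<open>Stopping at the exit from \<open>A\<close> loses only what is earned after a first
  landing in \<open>B - A\<close>, and such a landing itself contributes 0.\<close>

lemma exit_mean_mono_set:
  assumes "A \<subseteq> B" "\<And>y. y \<in> B - A \<Longrightarrow> h y = 0"
  shows "exit_mean A h x \<le> exit_mean B h x"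
  by (subst exit_mean_strong_Markov[OF assms(1)]) (auto intro!: exit_mean_mono simp: assms(2))

lemma exit_mean_one_le: "exit_mean A (\<lambda>y. 1) x \<le> 1"
  by (rule exit_mean_least) (auto intro!: order_trans[OF step_mono[where h="\<lambda>y. 1"]])

text \<open>A path that leaves \<open>B\<close> has left \<open>A\<close> by that time.\<close>

lemma exit_mean_one_mono:
  assumes "A \<subseteq> B"
  shows "exit_mean B (\<lambda>y. 1) x \<le> exit_mean A (\<lambda>y. 1) x"
  by (rule exit_mean_least, subst (2) exit_mean_unfold)
    (use assms exit_mean_one_le in \<open>auto intro!: step_mono\<close>)

end

section \<open>The renewal function of the descending ladder heights\<close>

lemma exit_path_iff:
  "exit_path A x as \<longleftrightarrow> as \<noteq> [] \<and>
     (\<forall>i. 1 \<le> i \<and> i < length as \<longrightarrow> x + sum_list (take i as) \<in> A) \<and> x + sum_list as \<notin> A"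
proof (induction A x as rule: exit_path.induct)
  case (2 A x a as)
  have *: "(\<forall>i. 1 \<le> i \<and> i < length (a # as) \<longrightarrow> x + sum_list (take i (a # as)) \<in> A) \<longleftrightarrow>
     (as \<noteq> [] \<longrightarrow> x + a \<in> A) \<and>
     (\<forall>i. 1 \<le> i \<and> i < length as \<longrightarrow> x + a + sum_list (take i as) \<in> A)" (is "?L \<longleftrightarrow> ?R")
  proof
    assume L: ?L
    show ?R
    proof (intro conjI impI allI)
      show "x + a \<in> A" if "as \<noteq> []" using L[rule_format, of 1] that by simp
      show "x + a + sum_list (take i as) \<in> A" if "1 \<le> i \<and> i < length as" for i
        using L[rule_format, of "Suc i"] that by (simp add: add.assoc)
    qed
  next
    assume R: ?R
    show ?L
    proof (intro allI impI)
      fix i assume i: "1 \<le> i \<and> i < length (a # as)"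
      then obtain j where j: "i = Suc j" by (cases i) auto
      show "x + sum_list (take i (a # as)) \<in> A"
        using R i by (cases j) (auto simp: j add.assoc)
    qed
  qed
  show ?case unfolding * using 2 by (auto simp: add.assoc)
qed simp

fun suffixes_nonpos :: "int list \<Rightarrow> bool" where
  "suffixes_nonpos [] \<longleftrightarrow> True"
| "suffixes_nonpos (a # as) \<longleftrightarrow> a + sum_list as \<le> 0 \<and> suffixes_nonpos as"

lemma suffixes_nonpos_iff:
  "suffixes_nonpos as \<longleftrightarrow> (\<forall>i. 1 \<le> i \<and> i \<le> length as \<longrightarrow> sum_list (take i (rev as)) \<le> 0)"
proof (induction as)
  case (Cons a as)
  have "(\<forall>i. 1 \<le> i \<and> i \<le> length (a # as) \<longrightarrow> sum_list (take i (rev (a # as))) \<le> 0) \<longleftrightarrow>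
     (\<forall>i. 1 \<le> i \<and> i \<le> length as \<longrightarrow> sum_list (take i (rev as)) \<le> 0) \<and> a + sum_list as \<le> 0"
    by (auto simp: le_Suc_eq sum_list_rev add.commute)
  with Cons show ?case by auto
qed simp

lemma sum_list_suffixes_nonpos: "suffixes_nonpos as \<Longrightarrow> sum_list as \<le> 0"
  by (cases as) auto

text \<open>Reversal turns suffix sums into partial sums from 0: the reversed path stays nonpositive
  until its last step, which is \<open>a\<close>.\<close>

lemma exit_path_rev_Cons:
  "exit_path {..0} 0 (rev (a # as)) \<longleftrightarrow> suffixes_nonpos as \<and> 0 < a + sum_list as"
  unfolding exit_path_iff suffixes_nonpos_iff by (auto simp: sum_list_rev add.commute)

section \<open>Time reversal and the renewal equation\<close>

context int_walk
begin

lemma weight_append [simp]: "weight (as @ bs) = weight as * weight bs"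
  by (induction as) (auto simp: mult.assoc)

lemma weight_rev [simp]: "weight (rev as) = weight as"
  by (induction as) (auto simp: mult.commute)

text \<open>The step lists with nonpositive suffix sums are those at whose end the walk has a weak descending
  ladder epoch, so \<open>green x\<close> is the expected number of weak descending ladder points in \<open>(-x, 0]\<close>
  (the origin included), that is, \<open>V\<^sub>d\<^sub>s (x - 1)\<close>.\<close>

definition green :: "int \<Rightarrow> ennreal" where
  "green x = (\<integral>\<^sup>+ as. (if suffixes_nonpos as \<and> 0 < x + sum_list as then weight as else 0)
     \<partial>count_space UNIV)"

lemma green_nonpos: "x \<le> 0 \<Longrightarrow> green x = 0"
  unfolding green_def using sum_list_suffixes_nonpos
  by (subst nn_integral_0_iff_AE) (force simp: AE_count_space)+

lemma green_mono: "x \<le> y \<Longrightarrow> green x \<le> green y"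
  unfolding green_def by (intro nn_integral_mono) auto

lemma green_ge_1: "0 < x \<Longrightarrow> 1 \<le> green x"
  unfolding green_def by (subst nn_integral_count_space_list) auto

text \<open>Reading a path backwards turns the paths of positive total all of whose proper
  suffixes have nonpositive sums into the first passages to the positive half-line.\<close>

lemma step_green:
  assumes "0 \<le> x"
  shows "step green x + (if 0 < x then 1 else 0) = green x + exit_mean {..0} (\<lambda>y. 1) 0"
proof -
  let ?I = "\<lambda>P (as :: int list). if P then weight as else 0 :: ennreal"
  let ?g = "\<lambda>bs. ?I (bs \<noteq> [] \<and> suffixes_nonpos (tl bs) \<and> 0 < x + sum_list bs) bs"
  let ?g1 = "\<lambda>bs. ?I (bs \<noteq> [] \<and> suffixes_nonpos bs \<and> 0 < x + sum_list bs) bs"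
  let ?g2 = "\<lambda>bs. ?I (bs \<noteq> [] \<and> suffixes_nonpos (tl bs) \<and> 0 < sum_list bs) bs"
  have "step green x = (\<integral>\<^sup>+ a. \<integral>\<^sup>+ as. weight as *
      (if suffixes_nonpos as \<and> 0 < x + a + sum_list as then 1 else 0) \<partial>count_space UNIV \<partial>p)"
    unfolding step_def green_def by (intro nn_integral_cong) auto
  also have "\<dots> = (\<integral>\<^sup>+ bs. ?g bs \<partial>count_space UNIV)"
    by (subst nn_integral_count_space_list, subst nn_integral_weight_Cons[symmetric])
      (auto intro!: nn_integral_cong simp: add.assoc)
  \<comment> \<open>The total of \<open>bs\<close> is either nonpositive, and then all suffix sums
    are, or positive, and then \<open>0 < x + sum_list bs\<close> is automatic because
    \<open>0 \<le> x\<close>.\<close>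
  also have "\<dots> = (\<integral>\<^sup>+ bs. ?g1 bs + ?g2 bs \<partial>count_space UNIV)"
  proof (intro nn_integral_cong)
    fix bs :: "int list"
    show "?g bs = ?g1 bs + ?g2 bs"
      using assms by (cases bs) auto
  qed
  also have "\<dots> = (\<integral>\<^sup>+ bs. ?g1 bs \<partial>count_space UNIV) + (\<integral>\<^sup>+ bs. ?g2 bs \<partial>count_space UNIV)"
    by (subst nn_integral_add) auto
  also have "(\<integral>\<^sup>+ bs. ?g2 bs \<partial>count_space UNIV) =
      (\<integral>\<^sup>+ bs. (if exit_path {..0} 0 (rev bs) then weight (rev bs) else 0) \<partial>count_space UNIV)"
  proof (intro nn_integral_cong)
    fix bs :: "int list"
    show "?g2 bs = (if exit_path {..0} 0 (rev bs) then weight (rev bs) else 0)"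
      by (cases bs) (use exit_path_rev_Cons in \<open>auto simp: mult.commute\<close>)
  qed
  also have "\<dots> = exit_mean {..0} (\<lambda>y. 1) 0"
    unfolding exit_mean_def by (subst nn_integral_count_space_rev[of "\<lambda>as. if exit_path {..0} 0 as then weight as else 0"])
      (simp cong: if_cong)
  \<comment> \<open>The empty path, excluded from \<open>?g1\<close>, is the summand 1 for
    \<open>0 < x\<close>.\<close>
  also have "(\<integral>\<^sup>+ bs. ?g1 bs \<partial>count_space UNIV) + (if 0 < x then 1 else 0) = green x"
    unfolding green_def by (subst (1 2) nn_integral_count_space_list) (auto simp: add.commute)
  ultimately show ?thesis by (simp add: ac_simps)
qed

text \<open>The expected number, within the next \<open>n\<close> steps, of new weak descending ladder points above \<open>-x\<close>
  for a walk that is now at height \<open>s\<close> above its running minimum \<open>0\<close>.\<close>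

definition records :: "nat \<Rightarrow> int \<Rightarrow> int \<Rightarrow> ennreal" where
  "records n x s = (\<integral>\<^sup>+ bs. (if bs \<noteq> [] \<and> length bs \<le> n \<and> suffixes_nonpos (tl bs) \<and>
     s + sum_list bs \<le> 0 \<and> 0 < x + s + sum_list bs then weight bs else 0) \<partial>count_space UNIV)"

definition green_upto :: "nat \<Rightarrow> int \<Rightarrow> ennreal" where
  "green_upto n x = (\<integral>\<^sup>+ as. (if length as \<le> n \<and> suffixes_nonpos as \<and> 0 < x + sum_list as
     then weight as else 0) \<partial>count_space UNIV)"

lemma green_SUP: "green x = (SUP n. green_upto n x)"
proof -
  let ?f = "\<lambda>n as. if length as \<le> n \<and> suffixes_nonpos as \<and> 0 < x + sum_list as then weight as else 0"
  have "(SUP n. ?f n as) = (if suffixes_nonpos as \<and> 0 < x + sum_list as then weight as else 0)" for as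
    by (intro antisym SUP_least SUP_upper2[of "length as"]) auto
  then have "green x = (\<integral>\<^sup>+ as. (SUP n. ?f n as) \<partial>count_space UNIV)"
    unfolding green_def by simp
  also have "\<dots> = (SUP n. green_upto n x)"
    unfolding green_upto_def
    by (intro nn_integral_monotone_convergence_SUP) (auto simp: incseq_def le_fun_def)
  finally show ?thesis .
qed

lemma green_upto_records: "green_upto n x = (if 0 < x then 1 else 0) + records n x 0"
proof -
  have "green_upto n x = (if 0 < x then 1 else 0) +
     (\<integral>\<^sup>+ a. \<integral>\<^sup>+ as. (if length (a # as) \<le> n \<and> suffixes_nonpos (a # as) \<and> 0 < x + sum_list (a # as)
     then weight (a # as) else 0) \<partial>count_space UNIV \<partial>count_space UNIV)"
    unfolding green_upto_def by (subst nn_integral_count_space_list) auto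
  also have "(\<integral>\<^sup>+ a. \<integral>\<^sup>+ as. (if length (a # as) \<le> n \<and> suffixes_nonpos (a # as) \<and> 0 < x + sum_list (a # as)
     then weight (a # as) else 0) \<partial>count_space UNIV \<partial>count_space UNIV) = records n x 0"
    unfolding records_def by (subst (2) nn_integral_count_space_list) (auto intro!: nn_integral_cong)
  finally show ?thesis .
qed

text \<open>If the first step keeps the walk above its minimum, the minimum is unchanged; otherwise
  the new position \<open>y\<close> is the new minimum and itself a record, so a fresh count begins
  with the remaining depth \<open>x + y\<close>.\<close>

lemma records_Suc:
  "records (Suc n) x s = step (\<lambda>y. if y \<in> {1..} then records n x y else green_upto n (x + y)) s"
proof -
  have *: "(\<integral>\<^sup>+ as. weight as * (if length as \<le> n \<and> suffixes_nonpos as \<and>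
       s + a + sum_list as \<le> 0 \<and> 0 < x + s + a + sum_list as then 1 else 0) \<partial>count_space UNIV) =
       (if s + a \<in> {1..} then records n x (s + a) else green_upto n (x + (s + a)))" (is "?L = _") for a
  proof (cases "s + a \<in> {1..}")
    case True
    have "?L = records n x (s + a)"
      unfolding records_def
    proof (intro nn_integral_cong)
      fix as :: "int list"
      show "weight as * (if length as \<le> n \<and> suffixes_nonpos as \<and>
         s + a + sum_list as \<le> 0 \<and> 0 < x + s + a + sum_list as then 1 else 0) =
        (if as \<noteq> [] \<and> length as \<le> n \<and> suffixes_nonpos (tl as) \<and>
         s + a + sum_list as \<le> 0 \<and> 0 < x + (s + a) + sum_list as then weight as else 0)"
        \<comment> \<open>Since \<open>0 < s + a\<close>, the total must be negative: the empty list
          is excluded and the condition on the full suffix is automatic.\<close>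
        using True by (cases as) auto
    qed
    with True show ?thesis by simp
  next
    case False
    have "?L = green_upto n (x + (s + a))"
      unfolding green_upto_def
    proof (intro nn_integral_cong)
      fix as :: "int list"
      show "weight as * (if length as \<le> n \<and> suffixes_nonpos as \<and>
         s + a + sum_list as \<le> 0 \<and> 0 < x + s + a + sum_list as then 1 else 0) =
        (if length as \<le> n \<and> suffixes_nonpos as \<and> 0 < x + (s + a) + sum_list as
         then weight as else 0)"
        using False sum_list_suffixes_nonpos[of as] by (auto simp: add.assoc)
    qed
    with False show ?thesis by simp
  qed
  have "records (Suc n) x s =
      (\<integral>\<^sup>+ a. \<integral>\<^sup>+ as. weight (a # as) * (if length as \<le> n \<and> suffixes_nonpos as \<and>
       s + a + sum_list as \<le> 0 \<and> 0 < x + s + a + sum_list as then 1 else 0)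
       \<partial>count_space UNIV \<partial>count_space UNIV)"
    unfolding records_def by (subst nn_integral_count_space_list) (auto intro!: nn_integral_cong simp: add.assoc)
  then show ?thesis
    unfolding nn_integral_weight_Cons * by (simp add: step_def)
qed

lemma records_0 [simp]: "records 0 x s = 0"
  unfolding records_def by (subst nn_integral_0_iff_AE) (auto simp: AE_count_space)

text \<open>Renewal at the first weak descending ladder point: every supersolution dominates the
  truncations. The bounds for \<open>records\<close> and \<open>green_upto\<close> refer to each
  other, hence the joint induction.\<close>

lemma green_least:
  assumes "\<And>x. (if 0 < x then 1 else 0) + exit_mean {1..} (\<lambda>y. g (x + y)) 0 \<le> g x"
  shows "green x \<le> g x"
proof -
  have "records n x s \<le> exit_mean {1..} (\<lambda>y. g (x + y)) s \<and> green_upto n x \<le> g x" for n x s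
  proof (induction n arbitrary: x s)
    case 0
    have "green_upto 0 x \<le> (if 0 < x then 1 else 0) + exit_mean {1..} (\<lambda>y. g (x + y)) 0"
      by (simp add: green_upto_records)
    also have "\<dots> \<le> g x" by (rule assms)
    finally show ?case by simp
  next
    case (Suc n)
    have *: "records (Suc n) x s \<le> exit_mean {1..} (\<lambda>y. g (x + y)) s" for x s
      unfolding records_Suc by (subst exit_mean_unfold) (auto intro!: step_mono simp: Suc.IH)
    have "green_upto (Suc n) x \<le> (if 0 < x then 1 else 0) + exit_mean {1..} (\<lambda>y. g (x + y)) 0"
      unfolding green_upto_records by (intro add_left_mono *)
    also have "\<dots> \<le> g x" by (rule assms)
    finally show ?case using * by simp
  qed
  then show ?thesis unfolding green_SUP by (intro SUP_least) auto
qed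

text \<open>Together with \<open>green_least\<close> this characterises \<open>green\<close> as the
  least solution of the renewal equation. The limit of \<open>records\<close> is a supersolution of
  the first-step equation for leaving \<open>{1..}\<close>.\<close>

lemma green_renewal_ge:
  "(if 0 < x then 1 else 0) + exit_mean {1..} (\<lambda>y. green (x + y)) 0 \<le> green x"
proof -
  define r where "r = (\<lambda>s. SUP n. records n x s)"
  have inc: "incseq (\<lambda>n. records n x s)" for s
    unfolding records_def incseq_def by (auto intro!: nn_integral_mono)
  have incg: "incseq (\<lambda>n. green_upto n y)" for y
    unfolding green_upto_def incseq_def by (auto intro!: nn_integral_mono)
  have "exit_mean {1..} (\<lambda>y. green (x + y)) s \<le> r s" for s
  proof (rule exit_mean_least)
    fix s
    have "step (\<lambda>y. if y \<in> {1..} then r y else green (x + y)) s =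
        step (\<lambda>y. SUP n. if y \<in> {1..} then records n x y else green_upto n (x + y)) s"
      by (intro step_cong) (auto simp: r_def green_SUP)
    also have "\<dots> = (SUP n. records (Suc n) x s)"
      unfolding records_Suc using inc incg by (intro step_SUP) (auto simp: incseq_def)
    also have "\<dots> \<le> r s"
      unfolding r_def by (intro SUP_mono) auto
    finally show "step (\<lambda>y. if y \<in> {1..} then r y else green (x + y)) s \<le> r s" .
  qed
  then have "(if 0 < x then 1 else 0) + exit_mean {1..} (\<lambda>y. green (x + y)) 0 \<le> (if 0 < x then 1 else 0) + r 0"
    by (intro add_left_mono)
  also have "\<dots> = green x"
    unfolding r_def green_SUP green_upto_records using inc
    by (subst ennreal_SUP_add_right) auto
  finally show ?thesis .
qed

lemma green_subadditive:
  assumes "0 \<le> b"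
  shows "green (a + b) \<le> green a + green b"
proof -
  \<comment> \<open>A supersolution for \<open>green_least\<close>. A ladder point that carries the
    argument from above \<open>b\<close> to at most \<open>b\<close> leaves \<open>green\<close> of
    a value at most \<open>b\<close>, which the summand \<open>green b\<close> covers.\<close>
  define g where "g z = (if b < z then green (z - b) + green b else green z)" for z
  have "green (a + b) \<le> g (a + b)"
  proof (rule green_least)
    fix x
    show "(if 0 < x then 1 else 0) + exit_mean {1..} (\<lambda>y. g (x + y)) 0 \<le> g x"
    proof (cases "b < x")
      case False
      have "exit_mean {1..} (\<lambda>y. g (x + y)) 0 = exit_mean {1..} (\<lambda>y. green (x + y)) 0"
        by (intro exit_mean_cong) (use False in \<open>auto simp: g_def\<close>)
      then show ?thesis using green_renewal_ge[of x] False by (simp add: g_def)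
    next
      case True
      have "exit_mean {1..} (\<lambda>y. g (x + y)) 0 \<le> exit_mean {1..} (\<lambda>y. green (x - b + y) + green b * 1) 0"
        by (intro exit_mean_mono)
          (auto simp: g_def algebra_simps intro!: add_increasing2 green_mono)
      also have "\<dots> = exit_mean {1..} (\<lambda>y. green (x - b + y)) 0 + green b * exit_mean {1..} (\<lambda>y. 1) 0"
        by (simp only: exit_mean_add exit_mean_cmult)
      also have "\<dots> \<le> exit_mean {1..} (\<lambda>y. green (x - b + y)) 0 + green b * 1"
        by (intro add_left_mono mult_left_mono exit_mean_one_le) auto
      finally have "(if 0 < x then 1 else 0) + exit_mean {1..} (\<lambda>y. g (x + y)) 0 \<le>
          1 + (exit_mean {1..} (\<lambda>y. green (x - b + y)) 0 + green b * 1)"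
        by (intro add_mono) auto
      also have "\<dots> \<le> green (x - b) + green b"
        using green_renewal_ge[of "x - b"] True by (simp add: add.assoc[symmetric] add_right_mono)
      finally show ?thesis using True by (simp add: g_def)
    qed
  qed
  also have "g (a + b) \<le> green a + green b"
    using assms by (auto simp: g_def intro!: add_increasing green_mono)
  finally show ?thesis .
qed

end

section \<open>Recurrent walks\<close>

lemma ennreal_add_cancel_right: "c < \<top> \<Longrightarrow> a + c = b + c \<longleftrightarrow> a = (b :: ennreal)"
  by (auto simp: add.commute[of _ c] ennreal_add_left_cancel)

locale recurrent_int_walk = int_walk +
  assumes return: "exit_mean (- {0}) (\<lambda>y. 1) 0 = 1"
    and irreducible: "\<And>y. \<exists>as. 0 < weight as \<and> sum_list as = y"
begin

text \<open>By recurrence \<open>r 0 = 1\<close>. A mean of numbers at most 1 that equals 1 forces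
  the value 1 wherever the walk can step, and this spreads along a path from 0 to
  \<open>x\<close>.\<close>

lemma exit_mean_one_point: "exit_mean (- {0}) (\<lambda>y. 1) x = 1"
proof -
  define r where "r = exit_mean (- {0}) (\<lambda>y. 1)"
  have r_le: "r y \<le> 1" for y unfolding r_def by (rule exit_mean_one_le)
  have r_step: "r y = step (\<lambda>z. if z = 0 then 1 else r z) y" for y
    unfolding r_def by (subst exit_mean_unfold) (auto intro!: step_cong)
  have spread: "r (y + a) = 1" if "r y = 1" "0 < pmf p a" for y a
  proof (cases "y + a = 0")
    case True
    then show ?thesis using return by (simp add: r_def)
  next
    case False
    let ?t = "\<lambda>z. if z = 0 then 1 else r z"
    have "step (\<lambda>z. 1 - ?t z) y + step ?t y = step (\<lambda>z. 1) y"
      unfolding step_add[symmetric] by (intro step_cong) (use r_le in \<open>auto simp: diff_add_cancel_ennreal\<close>)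
    then have "step (\<lambda>z. 1 - ?t z) y + 1 = 0 + 1"
      using that r_step[of y] by simp
    then have "step (\<lambda>z. 1 - ?t z) y = 0"
      by (subst (asm) ennreal_add_cancel_right) auto
    with step_ge[of a "\<lambda>z. 1 - ?t z" y] have "ennreal (pmf p a) * (1 - ?t (y + a)) = 0"
      by simp
    then have "1 - r (y + a) = 0" using that False by simp
    then have "1 \<le> r (y + a)" by (simp add: ennreal_minus_eq_0)
    with r_le show ?thesis by (simp add: antisym)
  qed
  have "r (y + sum_list as) = 1" if "0 < weight as" "r y = 1" for as y
    using that
  proof (induction as arbitrary: y)
    case (Cons a as)
    have a: "0 < pmf p a" "0 < weight as"
      using Cons.prems(1) by (auto simp: ennreal_zero_less_mult_iff)
    from Cons.IH[OF a(2) spread[OF Cons.prems(2) a(1)]] show ?case by (simp add: add.assoc)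
  qed simp
  moreover obtain as where "0 < weight as" "sum_list as = x" using irreducible by blast
  moreover have "r 0 = 1" using return by (simp add: r_def)
  ultimately show ?thesis unfolding r_def by (metis add_0)
qed

text \<open>Recurrence and translation make a visit to \<open>c\<close> certain, and that visit is
  outside \<open>A\<close>.\<close>

lemma exit_mean_one:
  assumes "c \<notin> A"
  shows "exit_mean A (\<lambda>y. 1) x = 1"
proof (rule antisym[OF exit_mean_one_le])
  have "1 = exit_mean (- {0}) (\<lambda>y. 1) (x - c)" by (simp add: exit_mean_one_point)
  also have "\<dots> = exit_mean (- {c}) (\<lambda>y. 1) x"
    using exit_mean_shift[of "- {0}" "\<lambda>y. 1" x "- c"] by (simp add: vimage_def Compl_eq)
  also have "\<dots> \<le> exit_mean A (\<lambda>y. 1) x"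
    using assms by (intro exit_mean_one_mono) auto
  finally show "1 \<le> exit_mean A (\<lambda>y. 1) x" .
qed

lemma exit_mean_const: "c \<notin> A \<Longrightarrow> exit_mean A (\<lambda>y. d) x = d"
  using exit_mean_cmult[of A d "\<lambda>y. 1" x] by (simp add: exit_mean_one)

lemma exit_mean_from: "exit_mean {..x} h x = exit_mean {..0} (\<lambda>k. h (x + k)) 0"
proof -
  have "(\<lambda>y. y + x) -` {..x} = {..0}" by auto
  then show ?thesis using exit_mean_shift[of "{..x}" h 0 x] by (simp add: add.commute)
qed

text \<open>The walk enters \<open>[R, \<infinity>)\<close> by a jump of its ladder process. Each
  level \<open>j\<close> below \<open>R\<close> is a strict ladder point at most once; bounding the
  probability of this by 1 leaves the sum over \<open>j\<close>.\<close>

lemma exit_mean_overshoot_le: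
  assumes "x < R"
  shows "exit_mean {..<R} h x \<le>
    (\<Sum>j\<in>{x..<R}. exit_mean {..0} (\<lambda>k. if R \<le> j + k then h (j + k) else 0) 0)"
  using assms
proof (induction "nat (R - x)" arbitrary: x rule: less_induct)
  case less
  let ?E = "exit_mean {..<R} h"
  let ?G = "\<lambda>j. exit_mean {..0} (\<lambda>k. if R \<le> j + k then h (j + k) else 0) 0"
  have "?E x = exit_mean {..x} (\<lambda>y. if y \<in> {..<R} then ?E y else h y) x"
    using less.prems by (intro exit_mean_strong_Markov) auto
  also have "\<dots> = exit_mean {..0} (\<lambda>k. if x + k \<in> {..<R} then ?E (x + k) else h (x + k)) 0"
    by (rule exit_mean_from)
  also have "\<dots> \<le> exit_mean {..0} (\<lambda>k. (if R \<le> x + k then h (x + k) else 0) + (\<Sum>j\<in>{x+1..<R}. ?G j)) 0"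
  proof (rule exit_mean_mono)
    fix k :: int assume k: "k \<notin> {..0}"
    show "(if x + k \<in> {..<R} then ?E (x + k) else h (x + k)) \<le>
      (if R \<le> x + k then h (x + k) else 0) + (\<Sum>j\<in>{x+1..<R}. ?G j)"
    proof (cases "x + k < R")
      case True
      then have "?E (x + k) \<le> (\<Sum>j\<in>{x+k..<R}. ?G j)" using k by (intro less.hyps) auto
      also have "\<dots> \<le> (\<Sum>j\<in>{x+1..<R}. ?G j)" using k by (intro sum_mono2) auto
      finally show ?thesis using True by simp
    qed auto
  qed
  also have "\<dots> = ?G x + (\<Sum>j\<in>{x+1..<R}. ?G j)"
    unfolding exit_mean_add by (subst exit_mean_const[of 1]) auto
  also have "\<dots> = (\<Sum>j\<in>{x..<R}. ?G j)"
  proof -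
    have "{x..<R} = insert x {x+1..<R}" using less.prems by auto
    then show ?thesis by simp
  qed
  finally show ?case .
qed

section \<open>Harmonicity, finiteness and optional stopping for \<open>green\<close>\<close>

lemma step_green_pos: "0 < x \<Longrightarrow> step green x = green x"
  using step_green[of x] by (simp add: exit_mean_one[of 1] ennreal_add_cancel_right)

text \<open>Here nothing cancels the passage probability 1 in \<open>step_green\<close>, which is
  why \<open>f_r(0) = 1\<close> although \<open>green 0 = 0\<close>.\<close>

lemma step_green_zero: "step green 0 = 1"
  using step_green[of 0] by (simp add: exit_mean_one[of 1] green_nonpos)

lemma ex_down_step: "\<exists>a<0. 0 < pmf p a"
proof -
  obtain as where as: "0 < weight as" "sum_list as = -1" using irreducible by blast
  have "\<exists>a\<in>set as. a < 0"
    using as(2) sum_list_nonneg[of as] by force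
  moreover have "0 < pmf p a" if "a \<in> set as" for a
    using as(1) that by (induction as) (auto simp: ennreal_zero_less_mult_iff)
  ultimately show ?thesis by blast
qed

text \<open>A Chernoff bound: if \<open>t < 1\<close> is the mean of \<open>2\<close> to the power of the first weak descending ladder
  point (a nonpositive number), then \<open>2\<close> to the power \<open>x\<close> times \<open>1 / (1 - t)\<close> is a supersolution of
  the renewal equation.\<close>

lemma green_finite: "green x < \<infinity>"
proof -
  let ?e = "\<lambda>y::int. ennreal (2 powr real_of_int y)"
  define T where "T = exit_mean {1..} ?e 0"
  define D where "D = exit_mean {1..} (\<lambda>y. ennreal (1 - 2 powr real_of_int y)) 0"
  \<comment> \<open>\<open>D\<close> is the deficit \<open>1 - T\<close>; it is positive because the
    first step can be negative.\<close>
  have "T + D = exit_mean {1..} (\<lambda>y. 1) 0"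
    unfolding T_def D_def exit_mean_add[symmetric]
  proof (intro exit_mean_cong)
    fix y :: int assume "y \<notin> {1..}"
    then have "2 powr real_of_int y \<le> 2 powr 0" by (intro powr_mono) auto
    then show "?e y + ennreal (1 - 2 powr real_of_int y) = 1"
      by (simp add: ennreal_plus[symmetric] del: ennreal_plus)
  qed
  then have TD: "T + D = 1" by (simp add: exit_mean_one[of 0])
  obtain a where a: "a < 0" "0 < pmf p a" using ex_down_step by blast
  have "(2::real) powr real_of_int a < 2 powr 0" using a by (intro powr_less_mono) auto
  then have "0 < ennreal (pmf p a) * (if 0 + a \<in> {1..} then exit_mean {1..} (\<lambda>y. ennreal (1 - 2 powr real_of_int y)) (0 + a)
      else ennreal (1 - 2 powr real_of_int (0 + a)))"
    using a by (simp add: ennreal_zero_less_mult_iff)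
  also have "\<dots> \<le> D"
    unfolding D_def by (subst (2) exit_mean_unfold) (rule step_ge)
  finally have D: "0 < D" .
  have "T < 1"
  proof (rule ccontr)
    assume "\<not> T < 1"
    then have "1 \<le> T" by simp
    moreover have "T \<le> 1" using TD by (metis le_iff_add)
    ultimately have "1 + D = 1 + 0" using TD by simp
    then show False using D by (subst (asm) ennreal_add_left_cancel) auto
  qed
  then obtain t where t: "T = ennreal t" "0 \<le> t" "t < 1"
    by (cases T) (auto simp: ennreal_less_one_iff)
  have "green x \<le> ennreal (1 / (1 - t)) * ?e x"
  proof (rule green_least)
    fix x
    have "exit_mean {1..} (\<lambda>y. ennreal (1 / (1 - t)) * ?e (x + y)) 0 =
        ennreal (1 / (1 - t)) * ?e x * T"
      unfolding T_def exit_mean_cmult[symmetric] using t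
      by (intro exit_mean_cong) (simp add: ennreal_mult[symmetric] powr_add mult_ac)
    also have "\<dots> = ennreal (1 / (1 - t) * 2 powr x * t)"
    proof -
      have "ennreal (1 / (1 - t) * 2 powr x * t) = ennreal (1 / (1 - t) * 2 powr x) * ennreal t"
        using t by (intro ennreal_mult) auto
      also have "ennreal (1 / (1 - t) * 2 powr x) = ennreal (1 / (1 - t)) * ?e x"
        using t by (intro ennreal_mult) auto
      finally show ?thesis unfolding t(1) by simp
    qed
    finally have e: "exit_mean {1..} (\<lambda>y. ennreal (1 / (1 - t)) * ?e (x + y)) 0 =
      ennreal (1 / (1 - t) * 2 powr x * t)" .
    \<comment> \<open>The indicator is at most \<open>2 powr x\<close>, and
      \<open>1 + t / (1 - t) = 1 / (1 - t)\<close>.\<close>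
    have "(if 0 < x then 1 else 0) \<le> (2::real) powr x"
      by (auto intro!: ge_one_powr_ge_zero)
    also have "2 powr x = (1 / (1 - t) * (1 - t)) * 2 powr x" using t by simp
    also have "\<dots> = 1 / (1 - t) * 2 powr x - 1 / (1 - t) * 2 powr x * t"
      unfolding right_diff_distrib left_diff_distrib by (simp only: mult_1_right mult_ac)
    finally have "(if 0 < x then 1 else 0) + 1 / (1 - t) * 2 powr x * t \<le> 1 / (1 - t) * 2 powr x"
      by simp
    then have "ennreal ((if 0 < x then 1 else 0) + 1 / (1 - t) * 2 powr x * t) \<le> ennreal (1 / (1 - t) * 2 powr x)"
      by (rule ennreal_leI)
    then show "(if 0 < x then 1 else 0) + exit_mean {1..} (\<lambda>y. ennreal (1 / (1 - t)) * ?e (x + y)) 0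
        \<le> ennreal (1 / (1 - t)) * ?e x"
      unfolding e using t ennreal_mult[of "1 / (1 - t)" "2 powr x", symmetric]
      by (auto simp: split: if_splits)
  qed
  also have "\<dots> < \<infinity>" by (simp add: ennreal_mult_less_top)
  finally show ?thesis .
qed

text \<open>Optional stopping with equality. Before the exit \<open>green\<close> is at most
  \<open>green R\<close>, so truncation at time \<open>n\<close> costs at most
  \<open>green R\<close> times the probability of no exit yet, which tends to 0. To avoid
  subtraction, \<open>green R\<close> times the exit probability is kept on the left.\<close>

lemma exit_mean_green:
  fixes R x :: int
  assumes "1 \<le> R"
  defines "h \<equiv> \<lambda>y. if R \<le> y then green y else 0"
  shows "exit_mean {1..<R} h x = step green x"
proof (rule antisym)
  have "exit_mean {1..<R} h x \<le> exit_mean {1..<R} green x"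
    unfolding h_def by (intro exit_mean_mono) auto
  also have "\<dots> \<le> step green x"
    by (intro exit_mean_step_le) (auto simp: step_green_pos)
  finally show "exit_mean {1..<R} h x \<le> step green x" .
next
  let ?one = "\<lambda>y::int. 1 :: ennreal"
  let ?A = "{1..<R}"
  \<comment> \<open>\<open>B\<close> is the induction step, stated for arbitrary \<open>x\<close>
    because the final start may be 0, where \<open>step green\<close> differs from
    \<open>green\<close>.\<close>
  have B: "step green x + green R * exit_upto (Suc n) ?A ?one x \<le> exit_upto (Suc n) ?A h x + green R"
    if "\<And>y. y \<in> ?A \<Longrightarrow> green y + green R * exit_upto n ?A ?one y \<le> exit_upto n ?A h y + green R" for n x
  proof -
    have "step green x + green R * exit_upto (Suc n) ?A ?one x =
      step (\<lambda>y. green y + green R * (if y \<in> ?A then exit_upto n ?A ?one y else 1)) x"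
      by (simp only: exit_upto.simps step_add step_cmult)
    also have "\<dots> \<le> step (\<lambda>y. (if y \<in> ?A then exit_upto n ?A h y else h y) + green R) x"
      by (intro step_mono) (use that assms in \<open>auto simp: h_def green_nonpos\<close>)
    also have "\<dots> = exit_upto (Suc n) ?A h x + green R"
      by (simp only: exit_upto.simps step_add step_const)
    finally show ?thesis .
  qed
  have A: "green y + green R * exit_upto n ?A ?one y \<le> exit_upto n ?A h y + green R" if "y \<in> ?A" for n y
    using that
  proof (induction n arbitrary: y)
    case 0
    then show ?case by (auto intro: green_mono)
  next
    case (Suc n)
    then show ?case using B[of n y] by (simp add: step_green_pos)
  qed
  have "step green x + green R * exit_upto n ?A ?one x \<le> exit_mean ?A h x + green R" for n
  proof -
    have "step green x + green R * exit_upto n ?A ?one x \<le> step green x + green R * exit_upto (Suc n) ?A ?one x"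
      by (intro add_left_mono mult_left_mono exit_upto_le_Suc) auto
    also have "\<dots> \<le> exit_upto (Suc n) ?A h x + green R" by (intro B A)
    also have "\<dots> \<le> exit_mean ?A h x + green R" by (intro add_right_mono exit_upto_le_mean)
    finally show ?thesis .
  qed
  then have "(SUP n. step green x + green R * exit_upto n ?A ?one x) \<le> exit_mean ?A h x + green R"
    by (intro SUP_least)
  also have "(SUP n. step green x + green R * exit_upto n ?A ?one x) = step green x + green R * exit_mean ?A ?one x"
    unfolding exit_mean_SUP SUP_mult_left_ennreal using incseq_exit_upto[of ?A ?one x]
    by (subst ennreal_SUP_add_right) (auto simp: incseq_def intro!: mult_left_mono)
  finally have "step green x + green R \<le> exit_mean ?A h x + green R"
    by (simp add: exit_mean_one[of 0])
  then show "step green x \<le> exit_mean ?A h x"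
    using green_finite[of R] by auto
qed

section \<open>Superharmonicity of the increments\<close>

definition green_diff :: "int \<Rightarrow> ennreal" where
  "green_diff x = green x - green (x - 1)"

lemma green_diff_add: "green_diff x + green (x - 1) = green x"
  unfolding green_diff_def by (intro diff_add_cancel_ennreal green_mono) auto

text \<open>\<open>green\<close> and its translate by 1 are both harmonic at \<open>x\<close>,
  except that for \<open>x = 1\<close> the translate is evaluated at 0, where its step mean 1
  exceeds its value 0. Hence only an inequality.\<close>

lemma step_green_diff_le:
  assumes "1 \<le> x"
  shows "step green_diff x \<le> green_diff x"
proof -
  have "step green_diff x + step green (x - 1) = step green x"
    using step_shift[of green x "-1"]
    by (simp add: step_add[symmetric] green_diff_add)
  also have "\<dots> = green_diff x + green (x - 1)"
    using assms by (simp add: step_green_pos green_diff_add)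
  finally have *: "step green_diff x + step green (x - 1) = green_diff x + green (x - 1)" .
  have "green (x - 1) \<le> step green (x - 1)"
    using assms by (cases "x = 1") (auto simp: green_nonpos step_green_pos)
  then have "step green_diff x + green (x - 1) \<le> green_diff x + green (x - 1)"
    unfolding *[symmetric] by (intro add_left_mono)
  then show ?thesis using green_finite[of "x - 1"]
    by auto
qed

text \<open>Superharmonicity iterated along the path; the condition on \<open>y\<close> keeps every
  position at least 1, where it is available.\<close>

lemma green_diff_along_path:
  "1 + sum_list (map abs as) \<le> y \<Longrightarrow> weight as * green_diff (y + sum_list as) \<le> green_diff y"
proof (induction as arbitrary: y)
  case (Cons a as)
  have "0 \<le> sum_list (map abs as)" by (intro sum_list_nonneg) auto
  with Cons.prems have y: "1 \<le> y" "1 + sum_list (map abs as) \<le> y + a" by auto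
  have "weight (a # as) * green_diff (y + sum_list (a # as)) =
      ennreal (pmf p a) * (weight as * green_diff (y + a + sum_list as))"
    by (simp add: mult.assoc add.assoc)
  also have "\<dots> \<le> ennreal (pmf p a) * green_diff (y + a)"
    by (intro mult_left_mono Cons.IH y) auto
  also have "\<dots> \<le> step green_diff y" by (rule step_ge)
  also have "\<dots> \<le> green_diff y" by (rule step_green_diff_le[OF y(1)])
  finally show ?case .
qed simp

text \<open>A local Harnack inequality: a fixed path of total \<open>- i\<close> leads from
  \<open>m + i\<close> back to \<open>m\<close>, and stays positive once \<open>m\<close> is
  large.\<close>

lemma green_diff_local:
  "\<exists>N c. 0 < c \<and> (\<forall>m\<ge>N. \<forall>i\<in>{0..int l}. c * green_diff m \<le> green_diff (m + i))"
proof (induction l)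
  case 0
  show ?case by (intro exI[of _ 0] exI[of _ 1]) auto
next
  case (Suc l)
  then obtain N c where c: "0 < c" "\<And>m i. N \<le> m \<Longrightarrow> i \<in> {0..int l} \<Longrightarrow> c * green_diff m \<le> green_diff (m + i)"
    by blast
  obtain as where as: "0 < weight as" "sum_list as = - int (Suc l)" using irreducible by blast
  let ?N = "max N (1 + sum_list (map abs as))" and ?c = "min c (weight as)"
  have "?c * green_diff m \<le> green_diff (m + i)" if "?N \<le> m" "i \<in> {0..int (Suc l)}" for m i
  proof (cases "i = int (Suc l)")
    case True
    have "?c * green_diff m \<le> weight as * green_diff (m + i + sum_list as)"
      using True as by (simp add: mult_right_mono)
    also have "\<dots> \<le> green_diff (m + i)"
      using that by (intro green_diff_along_path) auto
    finally show ?thesis .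
  next
    case False
    have "?c * green_diff m \<le> c * green_diff m" by (intro mult_right_mono) auto
    also have "\<dots> \<le> green_diff (m + i)" using that False by (intro c) auto
    finally show ?thesis .
  qed
  then show ?case using c(1) as(1) by (intro exI[of _ ?N] exI[of _ ?c]) auto
qed

end

section \<open>The Harnack inequality\<close>

lemma subadditive_growth:
  fixes f :: "int \<Rightarrow> real"
  assumes mono: "\<And>x y. 0 \<le> x \<Longrightarrow> x \<le> y \<Longrightarrow> f x \<le> f y"
    and pos: "\<And>x. 0 \<le> x \<Longrightarrow> 0 \<le> f x"
    and sub: "\<And>a b. 1 \<le> a \<Longrightarrow> 1 \<le> b \<Longrightarrow> f (a + b) \<le> f a + f b"
    and "1 \<le> m" "0 \<le> y"
  shows "f y \<le> (1 + real_of_int y / real_of_int m) * f m"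
  using \<open>0 \<le> y\<close>
proof (induction "nat y" arbitrary: y rule: less_induct)
  case less
  show ?case
  proof (cases "y \<le> m")
    case True
    have "f y \<le> 1 * f m" using mono[of y m] less.prems True by simp
    also have "\<dots> \<le> (1 + real_of_int y / real_of_int m) * f m"
      using \<open>1 \<le> m\<close> less.prems pos[of m] by (intro mult_right_mono) auto
    finally show ?thesis .
  next
    case False
    \<comment> \<open>Peel off one block of length \<open>m\<close>; the remainder has one block
      fewer.\<close>
    have "f y \<le> f m + f (y - m)" using sub[of m "y - m"] False \<open>1 \<le> m\<close> by simp
    also have "f (y - m) \<le> (1 + real_of_int (y - m) / real_of_int m) * f m"
      using False \<open>1 \<le> m\<close> by (intro less.hyps) auto
    also have "1 + real_of_int (y - m) / real_of_int m = real_of_int y / real_of_int m"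
      using \<open>1 \<le> m\<close> by (simp add: field_simps)
    finally show ?thesis by (simp add: distrib_right)
  qed
qed

text \<open>The Harnack inequality is assumed only while \<open>f\<close> stays below \<open>8 f n\<close>. At the first \<open>k\<^sub>0\<close> where
  this fails, the increments up to \<open>k\<^sub>0\<close> add up to a multiple of \<open>f n\<close>, so the increment at \<open>n\<close> is at
  least of order \<open>f n / k\<^sub>0\<close>; beyond \<open>k\<^sub>0\<close> the linear growth of subadditive functions suffices.\<close>

lemma increment_le_local_increment:
  fixes f :: "int \<Rightarrow> real" and c :: real
  assumes mono: "\<And>x y. 0 \<le> x \<Longrightarrow> x \<le> y \<Longrightarrow> f x \<le> f y"
    and pos: "\<And>x. 0 \<le> x \<Longrightarrow> 1 \<le> f x"
    and sub: "\<And>a b. 1 \<le> a \<Longrightarrow> 1 \<le> b \<Longrightarrow> f (a + b) \<le> f a + f b"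
    and c: "0 < c" and N: "1 \<le> N"
    and harnack: "\<And>n m. N \<le> n \<Longrightarrow> n < m \<Longrightarrow> f m \<le> 8 * f n \<Longrightarrow> c * (f m - f (m - 1)) \<le> f n - f (n - 1)"
    and n: "N \<le> n" "n \<le> R" "R \<le> 2 * n"
  shows "f (R + int k) - f R \<le> 6 / c * real k * (f n - f (n - 1))"
proof -
  define w where "w = (f n - f (n - 1)) / c"
  have w0: "0 \<le> w" using mono[of "n - 1" n] n N c by (simp add: w_def)
  have small: "f (R + int k) - f R \<le> real k * w" if "f (R + int k) \<le> 8 * f n" for k
    using that
  proof (induction k)
    case (Suc k)
    have le: "f (R + int k) \<le> f (R + int (Suc k))" using n N by (intro mono) auto
    have "c * (f (R + int (Suc k)) - f (R + int (Suc k) - 1)) \<le> f n - f (n - 1)"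
      using Suc.prems n by (intro harnack) auto
    then have "f (R + int (Suc k)) - f (R + int k) \<le> w"
      using c by (simp add: w_def field_simps)
    moreover have "f (R + int k) - f R \<le> real k * w" using Suc.prems le by (intro Suc.IH) auto
    ultimately show ?case by (simp add: algebra_simps)
  qed simp
  have "f (R + int k) - f R \<le> 6 * real k * w"
  proof (cases "f (R + int k) \<le> 8 * f n")
    case True
    have "real k * w \<le> 6 * real k * w" using w0 by simp
    with small[OF True] show ?thesis by linarith
  next
    case False
    define k0 where "k0 = (LEAST k. \<not> f (R + int k) \<le> 8 * f n)"
    have k0: "\<not> f (R + int k0) \<le> 8 * f n" "k0 \<le> k"
      unfolding k0_def using LeastI[of "\<lambda>k. \<not> f (R + int k) \<le> 8 * f n" k, OF False]
        Least_le[of "\<lambda>k. \<not> f (R + int k) \<le> 8 * f n" k, OF False] by blast+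
    have fn: "1 \<le> f n" using pos n N by simp
    have fR: "f R \<le> 2 * f n" using mono[of R "n + n"] sub[of n n] n N by simp
    \<comment> \<open>Otherwise subadditivity gives
      \<open>f (R + k0) \<le> 2 f R \<le> 4 f n\<close>, against the choice of
      \<open>k0\<close>.\<close>
    have "\<not> int k0 \<le> R"
    proof
      assume "int k0 \<le> R"
      then have "f (R + int k0) \<le> f (R + R)" using n N by (intro mono) auto
      also have "\<dots> \<le> f R + f R" using n N by (intro sub) auto
      finally show False using fR fn k0 by simp
    qed
    then have k0R: "R < int k0" by simp
    obtain j where j: "k0 = Suc j" using k0R n N by (cases k0) auto
    have "\<not> \<not> f (R + int j) \<le> 8 * f n"
      by (rule not_less_Least) (use j in \<open>simp add: k0_def\<close>)
    \<comment> \<open>The step from \<open>j\<close> to \<open>k0\<close> leaves the range of the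
      Harnack inequality, but costs at most \<open>f 1\<close>. So
      \<open>8 f n < 2 f n + j w + f n\<close>, whence the factor 5.\<close>
    then have "f (R + int j) - f R \<le> real j * w" by (intro small) auto
    moreover have "f (R + int k0) \<le> f (R + int j) + f 1"
      using sub[of "R + int j" 1] n N by (simp add: j add_ac)
    moreover have "f 1 \<le> f n" using n N by (intro mono) auto
    moreover have "real j * w \<le> real k0 * w" using w0 j by (intro mult_right_mono) auto
    ultimately have fnw: "5 * f n \<le> real k0 * w" using k0 fR by linarith
    have k0p: "0 < real k0" using j by simp
    have k0_le: "f (int k0) \<le> 9 * f n"
    proof -
      have "f (int k0) \<le> f (R + int j)" using n N by (intro mono) (auto simp: j)
      with \<open>\<not> \<not> f (R + int j) \<le> 8 * f n\<close> fn show ?thesis by simp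
    qed
    \<comment> \<open>Here \<open>R < k0 \<le> k\<close>, so \<open>R + k \<le> 2 k\<close> and
      \<open>1 + 2 k / k0 \<le> 3 k / k0\<close>; with \<open>9 f n \<le> 2 k0 w\<close> the
      constant is 3 times 2.\<close>
    have "f (R + int k) \<le> f (2 * int k)" using k0R k0 n N by (intro mono) auto
    also have "\<dots> \<le> (1 + real_of_int (2 * int k) / real_of_int (int k0)) * f (int k0)"
    proof (rule subadditive_growth)
      show "0 \<le> f x" if "0 \<le> x" for x using pos[OF that] by simp
    qed (use mono sub j in auto)
    also have "\<dots> \<le> (3 * (real k / real k0)) * (9 * f n)"
      using k0 k0p k0_le fn pos[of "int k0"] by (intro mult_mono) (auto simp: field_simps)
    also have "\<dots> \<le> (3 * (real k / real k0)) * (2 * (real k0 * w))"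
      using fnw k0p fn by (intro mult_left_mono) auto
    also have "\<dots> = 6 * real k * w" using k0p by simp
    finally show ?thesis using pos[of R] n N by simp
  qed
  then show ?thesis using c by (simp add: w_def field_simps)
qed

text \<open>Averages the local estimate over \<open>n\<close> in \<open>(y, R]\<close>, where the
  increments telescope.\<close>

lemma increment_le_average_increment:
  fixes f :: "int \<Rightarrow> real" and c :: real
  assumes mono: "\<And>x y. 0 \<le> x \<Longrightarrow> x \<le> y \<Longrightarrow> f x \<le> f y"
    and pos: "\<And>x. 0 \<le> x \<Longrightarrow> 1 \<le> f x"
    and sub: "\<And>a b. 1 \<le> a \<Longrightarrow> 1 \<le> b \<Longrightarrow> f (a + b) \<le> f a + f b"
    and c: "0 < c" and N: "1 \<le> N"
    and harnack: "\<And>n m. N \<le> n \<Longrightarrow> n < m \<Longrightarrow> f m \<le> 8 * f n \<Longrightarrow> c * (f m - f (m - 1)) \<le> f n - f (n - 1)"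
    and x: "0 \<le> x" "x + 2 * N \<le> R"
  shows "f (R + int k) - f R \<le> 12 / c * real k * (f R - f x) / real_of_int (R - x)"
proof -
  \<comment> \<open>Cutting at \<open>R / 2\<close> ensures \<open>N \<le> n\<close> and
    \<open>R \<le> 2 n\<close> on the range averaged over, and keeps at least half of
    \<open>(x, R]\<close>; this doubles the constant 6.\<close>
  define y where "y = max x (R div 2)"
  have y: "y < R" "0 \<le> y" "x \<le> y" "R - x \<le> 2 * (R - y)" using x N by (auto simp: y_def)
  define d where "d = f (R + int k) - f R"
  have d0: "0 \<le> d" using mono[of R "R + int k"] x N by (simp add: d_def)
  have tele: "(\<Sum>n\<in>{y+1..z}. f n - f (n - 1)) = f z - f y" if "y \<le> z" for z
    using that
  proof (induction z rule: int_ge_induct)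
    case (step z)
    have "{y+1..z+1} = insert (z+1) {y+1..z}" using step.hyps by auto
    then show ?case using step by simp
  qed simp
  have "real_of_int (R - y) * d = (\<Sum>n\<in>{y+1..R}. d)" using y by simp
  also have "\<dots> \<le> (\<Sum>n\<in>{y+1..R}. 6 / c * real k * (f n - f (n - 1)))"
  proof (intro sum_mono)
    fix n assume "n \<in> {y+1..R}"
    then show "d \<le> 6 / c * real k * (f n - f (n - 1))"
      unfolding d_def using x by (intro increment_le_local_increment[OF mono pos sub c N harnack]) (auto simp: y_def)
  qed
  also have "\<dots> = 6 / c * real k * (f R - f y)"
    using y by (simp only: sum_distrib_left[symmetric] tele)
  also have "\<dots> \<le> 6 / c * real k * (f R - f x)"
    using c mono[OF x(1) y(3)] by (intro mult_left_mono) auto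
  finally have 1: "real_of_int (R - y) * d \<le> 6 / c * real k * (f R - f x)" .
  have "real_of_int (R - x) \<le> 2 * real_of_int (R - y)" using y by linarith
  then have "real_of_int (R - x) * d \<le> 2 * real_of_int (R - y) * d"
    using d0 by (intro mult_right_mono)
  also have "\<dots> = 2 * (real_of_int (R - y) * d)" by simp
  also have "\<dots> \<le> 2 * (6 / c * real k * (f R - f x))" using 1 by (intro mult_left_mono) auto
  finally have "real_of_int (R - x) * d \<le> 12 / c * real k * (f R - f x)" by simp
  moreover have "0 < real_of_int (R - x)" using x N by simp
  ultimately show ?thesis unfolding d_def[symmetric] by (subst pos_le_divide_eq) (simp_all only: mult.commute)
qed

section \<open>Walks whose ladder height has finite mean\<close>

context int_walk
begin

lemma exit_mean_sum:
  assumes "finite S"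
  shows "exit_mean A (\<lambda>y. \<Sum>s\<in>S. h s y) x = (\<Sum>s\<in>S. exit_mean A (h s) x)"
  using assms by (induction S rule: finite_induct) (auto simp: exit_mean_add)

end

text \<open>Leaving \<open>{..0}\<close> from 0 happens at the first strict ascending ladder point,
  so the assumption is \<open>E Z < \<infinity>\<close>.\<close>

locale finite_mean_walk = recurrent_int_walk +
  assumes mean: "exit_mean {..0} (\<lambda>y. ennreal (real_of_int y)) 0 < \<infinity>"
begin

text \<open>On the nonnegative integers \<open>harm\<close> is \<open>f\<^sub>r\<close>: \<open>step green\<close> agrees with \<open>green\<close> on the positive
  integers, but has the value \<open>1\<close> at \<open>0\<close>, where \<open>green\<close> vanishes.\<close>

definition harm :: "int \<Rightarrow> real" where
  "harm x = enn2real (step green x)"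

lemma step_green_harm: "0 \<le> x \<Longrightarrow> step green x = ennreal (harm x)"
  using green_finite[of x] by (cases "x = 0") (auto simp: harm_def step_green_zero step_green_pos)

lemma green_harm: "0 < x \<Longrightarrow> green x = ennreal (harm x)"
  using step_green_harm[of x] step_green_pos[of x] by simp

lemma harm_zero: "harm 0 = 1"
  by (simp add: harm_def step_green_zero)

lemma harm_nonneg: "0 \<le> harm x"
  by (simp add: harm_def)

lemma harm_ge_1: "0 \<le> x \<Longrightarrow> 1 \<le> harm x"
  using green_ge_1[of x] harm_nonneg[of x] by (cases "x = 0") (auto simp: harm_zero green_harm)

lemma harm_mono: "0 \<le> x \<Longrightarrow> x \<le> y \<Longrightarrow> harm x \<le> harm y"
  using green_mono[of x y] harm_ge_1[of y] harm_nonneg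
  by (cases "x = 0") (auto simp: harm_zero green_harm)

lemma harm_subadditive:
  assumes "1 \<le> a" "1 \<le> b"
  shows "harm (a + b) \<le> harm a + harm b"
proof -
  have "ennreal (harm (a + b)) \<le> ennreal (harm a + harm b)"
    using green_subadditive[of b a] assms by (simp add: green_harm harm_nonneg)
  then show ?thesis using harm_nonneg[of a] harm_nonneg[of b]
    by (subst (asm) ennreal_le_iff) auto
qed

lemma harm_growth: "1 \<le> m \<Longrightarrow> 0 \<le> y \<Longrightarrow> harm y \<le> (1 + real_of_int y / real_of_int m) * harm m"
  by (rule subadditive_growth[OF harm_mono harm_nonneg harm_subadditive])

text \<open>The truncated mean \<open>E[Z; Z > l]\<close>.\<close>

definition tail :: "nat \<Rightarrow> ennreal" where
  "tail l = exit_mean {..0} (\<lambda>k. if int l < k then ennreal (real_of_int k) else 0) 0"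

lemma tail_antimono: "l \<le> m \<Longrightarrow> tail m \<le> tail l"
  unfolding tail_def by (intro exit_mean_mono) auto

text \<open>Monotone convergence for the part \<open>Z \<le> l\<close> of the mean; being finite,
  that part can be cancelled.\<close>

lemma tail_small:
  assumes "0 < e"
  shows "\<exists>l. tail l \<le> ennreal e"
proof -
  let ?h = "\<lambda>l k. if k \<le> int l then ennreal (real_of_int k) else 0"
  let ?m = "exit_mean {..0} (\<lambda>y. ennreal (real_of_int y)) 0"
  have h: "(SUP l. ?h l k) = ennreal (real_of_int k)" for k
    by (intro antisym SUP_least SUP_upper2[of "nat k"]) auto
  have "?m = exit_mean {..0} (\<lambda>k. SUP l. ?h l k) 0" by (simp only: h)
  also have "\<dots> = (SUP l. exit_mean {..0} (?h l) 0)"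
    by (intro exit_mean_SUP_fun) (auto simp: incseq_def)
  finally have m: "?m = (SUP l. exit_mean {..0} (?h l) 0)" .
  obtain l where l: "?m < exit_mean {..0} (?h l) 0 + ennreal e"
    using SUP_approx_ennreal[OF _ _ m, of e] assms mean by (auto simp: less_top)
  have split: "?m = exit_mean {..0} (?h l) 0 + tail l"
    unfolding tail_def exit_mean_add[symmetric] by (intro exit_mean_cong) auto
  then have "exit_mean {..0} (?h l) 0 + tail l \<le> exit_mean {..0} (?h l) 0 + ennreal e"
    using l split by (metis less_imp_le)
  moreover have "exit_mean {..0} (?h l) 0 < \<infinity>"
    using split mean by (metis ennreal_add_eq_top infinity_ennreal_def less_top)
  ultimately have "tail l \<le> ennreal e" unfolding ennreal_add_left_cancel_le by (metis less_irrefl)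
  then show ?thesis by blast
qed

text \<open>Sums over the ladder point \<open>j\<close> from which a ladder jump \<open>k\<close>
  crosses \<open>m\<close>. The jumps counted exceed \<open>l\<close>, and for given
  \<open>k\<close> the values of \<open>green\<close> at the admissible landings add up to at most
  \<open>3 k\<close> times \<open>green m\<close>.\<close>

lemma green_overshoot_le:
  assumes n: "1 \<le> n" "n < m"
  shows "exit_mean {1..<m} (\<lambda>y. if m + int l < y then green y else 0) n \<le> 3 * green m * tail l"
proof -
  let ?h = "\<lambda>y. if m + int l < y then green y else 0"
  have "exit_mean {1..<m} ?h n \<le> exit_mean {..<m} ?h n"
    using n by (intro exit_mean_mono_set) auto
  also have "\<dots> \<le> (\<Sum>j\<in>{n..<m}. exit_mean {..0} (\<lambda>k. if m \<le> j + k then ?h (j + k) else 0) 0)"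
    by (rule exit_mean_overshoot_le[OF n(2)])
  also have "\<dots> = exit_mean {..0} (\<lambda>k. \<Sum>j\<in>{n..<m}. if m \<le> j + k then ?h (j + k) else 0) 0"
    by (simp add: exit_mean_sum)
  also have "\<dots> \<le> exit_mean {..0} (\<lambda>k. 3 * green m * (if int l < k then ennreal (real_of_int k) else 0)) 0"
  proof (rule exit_mean_mono)
    fix k :: int assume "k \<notin> {..0}"
    then have k: "1 \<le> k" by simp
    let ?J = "{j \<in> {n..<m}. m + int l < j + k}"
    have "(\<Sum>j\<in>{n..<m}. if m \<le> j + k then ?h (j + k) else 0) = (\<Sum>j\<in>?J. green (j + k))"
      by (intro sum.mono_neutral_cong_right) auto
    also have "\<dots> \<le> (\<Sum>j\<in>?J. ennreal ((2 + real_of_int k / real_of_int m) * harm m))"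
    proof (intro sum_mono)
      fix j assume j: "j \<in> ?J"
      then have "green (j + k) \<le> green (m + k)" by (intro green_mono) auto
      also have "\<dots> = ennreal (harm (m + k))" using n k by (intro green_harm) auto
      also have "harm (m + k) \<le> (1 + real_of_int (m + k) / real_of_int m) * harm m"
        using n k by (intro harm_growth) auto
      also have "1 + real_of_int (m + k) / real_of_int m = 2 + real_of_int k / real_of_int m"
        using n by (simp add: field_simps)
      finally show "green (j + k) \<le> ennreal ((2 + real_of_int k / real_of_int m) * harm m)"
        by (simp add: ennreal_leI)
    qed
    also have "\<dots> = ennreal (real (card ?J) * ((2 + real_of_int k / real_of_int m) * harm m))"
      using n k harm_nonneg by (simp add: ennreal_mult ennreal_of_nat_eq_real_of_nat)
    also have "\<dots> \<le> 3 * green m * (if int l < k then ennreal (real_of_int k) else 0)"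
    proof (cases "int l < k")
      case False
      then have J: "?J = {}" by auto
      show ?thesis unfolding J by simp
    next
      case True
      \<comment> \<open>Both counts enter: at most \<open>k\<close> starting points for the constant
        2, at most \<open>m\<close> for the term \<open>k / m\<close>, giving
        \<open>2 k + k = 3 k\<close>.\<close>
      have "card ?J \<le> card {m - k..<m}" by (intro card_mono) auto
      then have c1: "real (card ?J) \<le> real_of_int k" using k by simp
      have "card ?J \<le> card {1..<m}" using n by (intro card_mono) auto
      then have c2: "real (card ?J) \<le> real_of_int m" using n by simp
      have "real (card ?J) * (2 + real_of_int k / real_of_int m) =
          2 * real (card ?J) + real (card ?J) * real_of_int k / real_of_int m" by (simp add: algebra_simps)
      also have "\<dots> \<le> 2 * real_of_int k + real_of_int m * real_of_int k / real_of_int m"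
        using c1 c2 k n by (intro add_mono mult_left_mono divide_right_mono mult_right_mono) auto
      finally have "real (card ?J) * (2 + real_of_int k / real_of_int m) \<le> 3 * real_of_int k"
        using n by simp
      then have "real (card ?J) * (2 + real_of_int k / real_of_int m) * harm m \<le> 3 * real_of_int k * harm m"
        by (intro mult_right_mono harm_nonneg)
      then have "ennreal (real (card ?J) * ((2 + real_of_int k / real_of_int m) * harm m)) \<le>
        ennreal (3 * harm m * real_of_int k)"
        by (intro ennreal_leI) (simp add: mult_ac)
      also have "\<dots> = 3 * green m * ennreal (real_of_int k)"
        using n k harm_nonneg by (simp add: green_harm ennreal_mult)
      finally show ?thesis using True by simp
    qed
    finally show "(\<Sum>j\<in>{n..<m}. if m \<le> j + k then ?h (j + k) else 0) \<le>
      3 * green m * (if int l < k then ennreal (real_of_int k) else 0)" .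
  qed
  also have "\<dots> = 3 * green m * tail l"
    unfolding tail_def by (rule exit_mean_cmult)
  finally show ?thesis .
qed

text \<open>Harmonicity splits \<open>harm n\<close> into the contribution of landings near \<open>m\<close>, at most their probability
  times \<open>harm (2 m)\<close>, and that of large overshoots, which is at most \<open>harm n / 2\<close>.\<close>

lemma landing_near:
  "\<exists>l. \<forall>n m. int l \<le> m \<and> 1 \<le> n \<and> n < m \<and> harm m \<le> 8 * harm n \<longrightarrow>
     ennreal (1 / 32) \<le> exit_mean {1..<m} (\<lambda>y. if y \<in> {m..m + int l} then 1 else 0) n"
proof -
  \<comment> \<open>As \<open>3 harm m \<le> 24 harm n\<close> and \<open>24 / 48 = 1 / 2\<close>,
    large overshoots cost at most half; as \<open>harm (m + m) \<le> 16 harm n\<close>, near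
    landings have probability at least \<open>(1 / 2) / 16\<close>.\<close>
  obtain l where l: "tail l \<le> ennreal (1 / 48)" using tail_small[of "1 / 48"] by auto
  show ?thesis
  proof (intro exI[of _ l] allI impI, elim conjE)
    fix n m assume m: "int l \<le> m" and n: "1 \<le> n" "n < m" and g: "harm m \<le> 8 * harm n"
    let ?P = "exit_mean {1..<m} (\<lambda>y. if y \<in> {m..m + int l} then 1 else 0) n"
    have "ennreal (harm n) = exit_mean {1..<m} (\<lambda>y. if m \<le> y then green y else 0) n"
      using n by (subst exit_mean_green) (auto simp: step_green_harm)
    also have "\<dots> \<le> exit_mean {1..<m} (\<lambda>y. green (m + int l) * (if y \<in> {m..m + int l} then 1 else 0) +
        (if m + int l < y then green y else 0)) n"
      by (intro exit_mean_mono) (auto intro!: green_mono)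
    also have "\<dots> = green (m + int l) * ?P + exit_mean {1..<m} (\<lambda>y. if m + int l < y then green y else 0) n"
      by (simp only: exit_mean_add exit_mean_cmult)
    also have "\<dots> \<le> green (m + m) * ?P + 3 * green m * tail l"
      using m n by (intro add_mono mult_right_mono green_mono green_overshoot_le) auto
    also have "\<dots> \<le> ennreal (16 * harm n) * ?P + ennreal (24 * harm n) * ennreal (1 / 48)"
    proof (intro add_mono mult_right_mono mult_mono l)
      show "green (m + m) \<le> ennreal (16 * harm n)"
        using harm_subadditive[of m m] n g by (subst green_harm) (auto intro!: ennreal_leI)
      have "3 * green m = ennreal (3 * harm m)"
        using n harm_nonneg[of m] by (simp add: green_harm ennreal_mult)
      then show "3 * green m \<le> ennreal (24 * harm n)" using g by (simp add: ennreal_leI)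
    qed auto
    also have "ennreal (24 * harm n) * ennreal (1 / 48) = ennreal (harm n / 2)"
      using harm_nonneg[of n] by (subst ennreal_mult[symmetric]) auto
    finally have *: "ennreal (harm n) \<le> ennreal (16 * harm n) * ?P + ennreal (harm n / 2)" .
    have "?P \<le> exit_mean {1..<m} (\<lambda>y. 1) n" by (intro exit_mean_mono) auto
    then have "?P \<le> 1" using exit_mean_one_le order_trans by blast
    then obtain q where q: "?P = ennreal q" "0 \<le> q" by (cases ?P) (auto simp: top_unique)
    have h: "1 \<le> harm n" using n by (intro harm_ge_1) auto
    have "ennreal (harm n) \<le> ennreal (16 * harm n * q + harm n / 2)"
      using * q h by (simp add: ennreal_mult ennreal_plus)
    then have "harm n \<le> 16 * harm n * q + harm n / 2"
      using q h by (subst (asm) ennreal_le_iff) auto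
    then have "harm n * (1 / 32) \<le> harm n * q" by simp
    then have "1 / 32 \<le> q" using h by (subst (asm) mult_le_cancel_left_pos) auto
    then show "ennreal (1 / 32) \<le> ?P" unfolding q(1) by (rule ennreal_leI)
  qed
qed

text \<open>The range of \<open>x\<close> matters: at \<open>x = 1\<close> the two sides differ,
  since \<open>green 0 = 0\<close> but \<open>harm 0 = 1\<close>.\<close>

lemma harm_diff: "1 < x \<Longrightarrow> green_diff x = ennreal (harm x - harm (x - 1))"
  unfolding green_diff_def by (simp add: green_harm harm_nonneg ennreal_minus)

text \<open>From \<open>n\<close> the walk lands in \<open>{m..m + l}\<close> with probability at
  least \<open>1 / 32\<close>, and there the increment is at least a multiple of that at
  \<open>m\<close>; optional stopping for the superharmonic increments concludes.\<close>

lemma harm_harnack: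
  "\<exists>N c. 0 < c \<and> 1 \<le> N \<and> (\<forall>n m. N \<le> n \<and> n < m \<and> harm m \<le> 8 * harm n \<longrightarrow>
     c * (harm m - harm (m - 1)) \<le> harm n - harm (n - 1))"
proof -
  obtain l where l: "\<And>n m. int l \<le> m \<Longrightarrow> 1 \<le> n \<Longrightarrow> n < m \<Longrightarrow> harm m \<le> 8 * harm n \<Longrightarrow>
     ennreal (1 / 32) \<le> exit_mean {1..<m} (\<lambda>y. if y \<in> {m..m + int l} then 1 else 0) n"
    using landing_near by blast
  obtain N c where c: "0 < c" "\<And>m i. N \<le> m \<Longrightarrow> i \<in> {0..int l} \<Longrightarrow> c * green_diff m \<le> green_diff (m + i)"
    using green_diff_local[of l] by blast
  \<comment> \<open>The comparison constant may be infinite in \<open>ennreal\<close>; a finite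
    positive \<open>b\<close> below it suffices.\<close>
  obtain b where b: "0 < b" "ennreal b \<le> c"
  proof (cases c)
    case (real r)
    then show ?thesis using c(1) that[of r] by auto
  next
    case top
    then show ?thesis using that[of 1] by auto
  qed
  have "b / 32 * (harm m - harm (m - 1)) \<le> harm n - harm (n - 1)"
    if nm: "max 2 (max N (int l)) \<le> n" "n < m" "harm m \<le> 8 * harm n" for n m
  proof -
    have dm: "harm (m - 1) \<le> harm m" and dn: "harm (n - 1) \<le> harm n"
      using nm by (auto intro!: harm_mono)
    have "ennreal (b / 32 * (harm m - harm (m - 1))) = ennreal b * green_diff m * ennreal (1 / 32)"
      using nm b dm by (simp add: harm_diff ennreal_mult[symmetric])
    also have "\<dots> \<le> ennreal b * green_diff m * exit_mean {1..<m} (\<lambda>y. if y \<in> {m..m + int l} then 1 else 0) n"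
      using nm by (intro mult_left_mono l) auto
    also have "\<dots> = exit_mean {1..<m} (\<lambda>y. ennreal b * green_diff m * (if y \<in> {m..m + int l} then 1 else 0)) n"
      by (rule exit_mean_cmult[symmetric])
    also have "\<dots> \<le> exit_mean {1..<m} green_diff n"
    proof (rule exit_mean_mono)
      fix y
      show "ennreal b * green_diff m * (if y \<in> {m..m + int l} then 1 else 0) \<le> green_diff y"
      proof (cases "y \<in> {m..m + int l}")
        case True
        have "ennreal b * green_diff m \<le> c * green_diff m" using b by (intro mult_right_mono) auto
        also have "\<dots> \<le> green_diff (m + (y - m))" using nm True by (intro c) auto
        finally show ?thesis using True by simp
      qed auto
    qed
    also have "\<dots> \<le> step green_diff n"
      by (rule exit_mean_step_le, rule step_green_diff_le) auto
    also have "\<dots> \<le> green_diff n" using nm by (intro step_green_diff_le) auto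
    also have "\<dots> = ennreal (harm n - harm (n - 1))" using nm by (intro harm_diff) auto
    finally show ?thesis using dn by (subst (asm) ennreal_le_iff) auto
  qed
  then show ?thesis using b(1) by (intro exI[of _ "max 2 (max N (int l))"] exI[of _ "b / 32"]) auto
qed

lemma harm_increment:
  "\<exists>N C. 0 < C \<and> 1 \<le> N \<and> (\<forall>x R k. 0 \<le> x \<and> x + N \<le> R \<longrightarrow>
     harm (R + int k) - harm R \<le> C * real k * (harm R - harm x) / real_of_int (R - x))"
proof -
  obtain N c where c: "0 < c" "1 \<le> N" "\<And>n m. N \<le> n \<Longrightarrow> n < m \<Longrightarrow> harm m \<le> 8 * harm n \<Longrightarrow>
     c * (harm m - harm (m - 1)) \<le> harm n - harm (n - 1)"
    using harm_harnack by blast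
  have "harm (R + int k) - harm R \<le> 12 / c * real k * (harm R - harm x) / real_of_int (R - x)"
    if "0 \<le> x \<and> x + 2 * N \<le> R" for x R k
    using that c by (intro increment_le_average_increment[OF harm_mono harm_ge_1 harm_subadditive c]) auto
  then show ?thesis using c by (intro exI[of _ "2 * N"] exI[of _ "12 / c"]) auto
qed

end

section \<open>Two-sided exit\<close>

context finite_mean_walk
begin

text \<open>For \<open>0 < R\<close> this is \<open>P_x[T < sigma_R]\<close>, with
  \<open>sigma_R\<close> the entrance time of \<open>[R, \<infinity>)\<close>; likewise
  \<open>hit_zero\<close> is \<open>P_x[sigma_0 < sigma_R]\<close>.\<close>

definition hit_below :: "int \<Rightarrow> int \<Rightarrow> ennreal" where
  "hit_below x R = exit_mean {1..<R} (\<lambda>y. if y \<le> 0 then 1 else 0) x"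

definition hit_zero :: "int \<Rightarrow> int \<Rightarrow> ennreal" where
  "hit_zero x R = exit_mean ({..<R} - {0}) (\<lambda>y. if y = 0 then 1 else 0) x"

text \<open>Repeating one fixed negative step brings the walk to \<open>{..0}\<close>.\<close>

lemma hit_below_pos:
  assumes "0 \<le> x" "x < R"
  shows "0 < hit_below x R"
proof -
  obtain a where a: "a < 0" "0 < pmf p a" using ex_down_step by blast
  show ?thesis using assms
  proof (induction "nat x" arbitrary: x rule: less_induct)
    case less
    have "0 < (if x + a \<in> {1..<R} then hit_below (x + a) R else if x + a \<le> 0 then 1 else 0)"
      using less a by auto
    then have "0 < ennreal (pmf p a) * \<dots>"
      using a by (simp add: ennreal_zero_less_mult_iff)
    also have "\<dots> \<le> hit_below x R"
      unfolding hit_below_def by (subst (2) exit_mean_unfold) (rule step_ge)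
    finally show ?case .
  qed
qed

lemma hit_below_le_1: "hit_below x R \<le> 1"
  unfolding hit_below_def by (rule order_trans[OF exit_mean_mono exit_mean_one_le]) auto

text \<open>A Cesaro argument: \<open>tail\<close> is small except for the \<open>l\<close> values
  of \<open>j\<close> next to \<open>R\<close>, where it is at most \<open>tail 0\<close>. The
  threshold concerns \<open>R - x\<close> alone, which gives the uniformity in
  \<open>x\<close>.\<close>

lemma sum_tail_le:
  assumes "0 < e"
  shows "\<exists>r. \<forall>x R. r \<le> R - x \<longrightarrow> (\<Sum>j\<in>{x..<R}. tail (nat (R - j))) \<le> ennreal (e * real_of_int (R - x))"
proof -
  obtain l where l: "tail l \<le> ennreal (e / 2)" using tail_small[of "e / 2"] assms by auto
  have "tail 0 \<le> exit_mean {..0} (\<lambda>y. ennreal (real_of_int y)) 0"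
    unfolding tail_def by (intro exit_mean_mono) auto
  with mean have "tail 0 < \<infinity>" by (rule order_le_less_trans[rotated])
  then obtain t where t: "tail 0 = ennreal t" "0 \<le> t" by (cases "tail 0") auto
  \<comment> \<open>Large enough for \<open>l * t \<le> e / 2 * (R - x)\<close>.\<close>
  define r where "r = max 1 \<lceil>2 * real l * t / e\<rceil>"
  have "(\<Sum>j\<in>{x..<R}. tail (nat (R - j))) \<le> ennreal (e * real_of_int (R - x))" if "r \<le> R - x" for x R
  proof -
    have "(\<Sum>j\<in>{x..<R}. tail (nat (R - j))) \<le> (\<Sum>j\<in>{x..<R}. ennreal (e / 2 + (if R - int l < j then t else 0)))"
    proof (intro sum_mono)
      fix j assume "j \<in> {x..<R}"
      show "tail (nat (R - j)) \<le> ennreal (e / 2 + (if R - int l < j then t else 0))"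
      proof (cases "R - int l < j")
        case True
        have "tail (nat (R - j)) \<le> ennreal t" unfolding t(1)[symmetric] by (intro tail_antimono) auto
        also have "\<dots> \<le> ennreal (e / 2 + t)" using assms by (intro ennreal_leI) auto
        finally show ?thesis using True by simp
      next
        case False
        have "tail (nat (R - j)) \<le> tail l" using False by (intro tail_antimono) auto
        also note l
        finally show ?thesis using False by simp
      qed
    qed
    also have "\<dots> = ennreal (\<Sum>j\<in>{x..<R}. e / 2 + (if R - int l < j then t else 0))"
      using assms t by (intro sum_ennreal) auto
    also have "\<dots> \<le> ennreal (e * real_of_int (R - x))"
    proof (rule ennreal_leI)
      have "(\<Sum>j\<in>{x..<R}. if R - int l < j then t else 0) = (\<Sum>j\<in>{j \<in> {x..<R}. R - int l < j}. t)"
        by (intro sum.mono_neutral_cong_right) auto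
      also have "\<dots> \<le> (\<Sum>j\<in>{R - int l..<R}. t)"
        using t by (intro sum_mono2) auto
      also have "\<dots> = real l * t" by simp
      also have "\<dots> \<le> e / 2 * real_of_int (R - x)"
      proof -
        have "2 * real l * t / e \<le> real_of_int (R - x)"
          using that unfolding r_def by linarith
        then show ?thesis using assms by (simp add: field_simps)
      qed
      finally have "(\<Sum>j\<in>{x..<R}. if R - int l < j then t else 0) \<le> e / 2 * real_of_int (R - x)" .
      moreover have "(\<Sum>j\<in>{x..<R}. e / 2) = e / 2 * real_of_int (R - x)"
        using that by (simp add: r_def)
      ultimately have "(\<Sum>j\<in>{x..<R}. e / 2 + (if R - int l < j then t else 0)) \<le>
          e / 2 * real_of_int (R - x) + e / 2 * real_of_int (R - x)"
        unfolding sum.distrib by linarith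
      then show "(\<Sum>j\<in>{x..<R}. e / 2 + (if R - int l < j then t else 0)) \<le> e * real_of_int (R - x)"
        by simp
    qed
    finally show ?thesis .
  qed
  then show ?thesis by blast
qed

text \<open>A ladder jump \<open>k\<close> from \<open>j\<close> overshoots \<open>R\<close> by
  \<open>k - (R - j)\<close>, which is at most \<open>k\<close> and is 0 at
  \<open>k = R - j\<close>; hence the strict truncation in \<open>tail\<close> loses
  nothing.\<close>

lemma mean_overshoot_le:
  assumes "x < R"
  shows "exit_mean {1..<R} (\<lambda>y. if R \<le> y then ennreal (real_of_int (y - R)) else 0) x \<le>
    (\<Sum>j\<in>{x..<R}. tail (nat (R - j)))"
proof -
  let ?h = "\<lambda>y. if R \<le> y then ennreal (real_of_int (y - R)) else 0"
  have "exit_mean {1..<R} ?h x \<le> exit_mean {..<R} ?h x"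
    by (intro exit_mean_mono_set) auto
  also have "\<dots> \<le> (\<Sum>j\<in>{x..<R}. exit_mean {..0} (\<lambda>k. if R \<le> j + k then ?h (j + k) else 0) 0)"
    by (rule exit_mean_overshoot_le[OF assms])
  also have "\<dots> \<le> (\<Sum>j\<in>{x..<R}. tail (nat (R - j)))"
    unfolding tail_def by (intro sum_mono exit_mean_mono) (auto intro!: ennreal_leI)
  finally show ?thesis .
qed

text \<open>Optional stopping for \<open>green\<close>, with \<open>harm y\<close> split into
  \<open>harm R\<close> and the excess; the probability \<open>U\<close> of the upper exit is then
  replaced by 1 minus that of the lower exit.\<close>

lemma hit_below_identity:
  assumes "0 \<le> x" "x < R"
  shows "harm R * enn2real (hit_below x R) = harm R - harm x +
    enn2real (exit_mean {1..<R} (\<lambda>y. if R \<le> y then ennreal (harm y - harm R) else 0) x)"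
proof -
  define D where "D = exit_mean {1..<R} (\<lambda>y. if R \<le> y then ennreal (harm y - harm R) else 0) x"
  define U where "U = exit_mean {1..<R} (\<lambda>y. if R \<le> y then 1 else 0) x"
  have "hit_below x R + U = exit_mean {1..<R} (\<lambda>y. 1) x"
    unfolding hit_below_def U_def exit_mean_add[symmetric]
    by (intro exit_mean_cong) (use assms in auto)
  then have hU: "hit_below x R + U = 1" by (simp add: exit_mean_one[of 0])
  have "ennreal (harm R) * U + D = exit_mean {1..<R} (\<lambda>y. if R \<le> y then green y else 0) x"
    unfolding U_def D_def exit_mean_cmult[symmetric] exit_mean_add[symmetric]
  proof (intro exit_mean_cong)
    fix y
    have "ennreal (harm R) + ennreal (harm y - harm R) = green y" if "R \<le> y"
      using that assms harm_mono[of R y] harm_nonneg[of R]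
      by (simp add: green_harm ennreal_plus[symmetric] del: ennreal_plus)
    then show "ennreal (harm R) * (if R \<le> y then 1 else 0) + (if R \<le> y then ennreal (harm y - harm R) else 0) =
      (if R \<le> y then green y else 0)" by simp
  qed
  also have "\<dots> = ennreal (harm x)"
    using assms by (simp add: exit_mean_green step_green_harm)
  finally have UD: "ennreal (harm R) * U + D = ennreal (harm x)" .
  obtain a where a: "hit_below x R = ennreal a" "0 \<le> a"
    using hit_below_le_1[of x R] by (cases "hit_below x R") (auto simp: top_unique)
  obtain u where u: "U = ennreal u" "0 \<le> u" using hU by (cases U) auto
  obtain d where d: "D = ennreal d" "0 \<le> d" using UD by (cases D) auto
  have au: "a + u = 1" using hU a u by (simp add: ennreal_plus[symmetric] del: ennreal_plus)
  have "ennreal (harm R * u + d) = ennreal (harm x)"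
    using UD u d harm_nonneg[of R] by (simp add: ennreal_mult)
  then have "harm R * u + d = harm x"
    using u d harm_nonneg by (subst (asm) ennreal_inj) auto
  moreover have "harm R * a + harm R * u = harm R"
    using au by (metis distrib_left mult.right_neutral)
  ultimately have "harm R * a = harm R - harm x + d" by simp
  then show ?thesis using a d by (simp add: D_def[symmetric])
qed

lemma hit_below_asymptotics:
  assumes "0 < e"
  shows "\<exists>r. \<forall>x R. 0 \<le> x \<and> x < R \<and> r \<le> R - x \<longrightarrow> harm x < harm R \<and>
    harm R - harm x \<le> harm R * enn2real (hit_below x R) \<and>
    harm R * enn2real (hit_below x R) \<le> (1 + e) * (harm R - harm x)"
proof -
  obtain N C where C: "0 < C" "1 \<le> N" "\<And>x R k. 0 \<le> x \<Longrightarrow> x + N \<le> R \<Longrightarrow>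
     harm (R + int k) - harm R \<le> C * real k * (harm R - harm x) / real_of_int (R - x)"
    using harm_increment by blast
  \<comment> \<open>The factor \<open>e / C\<close> cancels the constant of the increment
    bound.\<close>
  obtain r where r: "\<And>x R. r \<le> R - x \<Longrightarrow>
      (\<Sum>j\<in>{x..<R}. tail (nat (R - j))) \<le> ennreal (e / C * real_of_int (R - x))"
    using sum_tail_le[of "e / C"] assms C by auto
  show ?thesis
  proof (intro exI[of _ "max r N"] allI impI, elim conjE)
    fix x R assume x: "0 \<le> x" "x < R" "max r N \<le> R - x"
    let ?D = "exit_mean {1..<R} (\<lambda>y. if R \<le> y then ennreal (harm y - harm R) else 0) x"
    define q where "q = C * (harm R - harm x) / real_of_int (R - x)"
    have mono: "harm x \<le> harm R" using x by (intro harm_mono) auto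
    have q: "0 \<le> q" using C x mono by (simp add: q_def)
    have "?D \<le> exit_mean {1..<R} (\<lambda>y. ennreal q * (if R \<le> y then ennreal (real_of_int (y - R)) else 0)) x"
    proof (rule exit_mean_mono)
      fix y
      show "(if R \<le> y then ennreal (harm y - harm R) else 0) \<le>
        ennreal q * (if R \<le> y then ennreal (real_of_int (y - R)) else 0)"
      proof (cases "R \<le> y")
        case True
        have "harm y - harm R \<le> q * real_of_int (y - R)"
          using C(3)[of x R "nat (y - R)"] x True by (simp add: q_def mult_ac)
        then have "ennreal (harm y - harm R) \<le> ennreal (q * real_of_int (y - R))" by (rule ennreal_leI)
        also have "\<dots> = ennreal q * ennreal (real_of_int (y - R))"
          using True q by (intro ennreal_mult) auto
        finally show ?thesis using True by simp
      qed simp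
    qed
    also have "\<dots> = ennreal q * exit_mean {1..<R} (\<lambda>y. if R \<le> y then ennreal (real_of_int (y - R)) else 0) x"
      by (rule exit_mean_cmult)
    also have "\<dots> \<le> ennreal q * ennreal (e / C * real_of_int (R - x))"
      using x by (intro mult_left_mono order_trans[OF mean_overshoot_le r]) auto
    also have "\<dots> = ennreal (q * (e / C * real_of_int (R - x)))"
      using q assms C x by (intro ennreal_mult[symmetric]) auto
    also have "q * (e / C * real_of_int (R - x)) = e * (harm R - harm x)"
      using C x by (simp add: q_def)
    finally have "enn2real ?D \<le> e * (harm R - harm x)"
      using assms mono by (intro enn2real_leI) auto
    moreover have "0 \<le> enn2real ?D" by simp
    moreover note hit_below_identity[OF x(1,2)]
    moreover have "0 < harm R * enn2real (hit_below x R)"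
      using hit_below_pos[OF x(1,2)] hit_below_le_1[of x R] harm_ge_1[of R] x
      by (intro mult_pos_pos) (auto simp: enn2real_positive_iff less_top[symmetric] top_unique)
    ultimately show "harm x < harm R \<and>
      harm R - harm x \<le> harm R * enn2real (hit_below x R) \<and>
      harm R * enn2real (hit_below x R) \<le> (1 + e) * (harm R - harm x)"
      \<comment> \<open>If \<open>harm x = harm R\<close>, the upper bound would vanish, contrary to
        the positivity of the lower exit probability.\<close>
      using mono by (cases "harm x = harm R") (auto simp: algebra_simps)
  qed
qed

section \<open>Hitting the origin before the upper barrier\<close>

lemma hit_zero_mono: "R \<le> S \<Longrightarrow> hit_zero x R \<le> hit_zero x S"
  unfolding hit_zero_def by (intro exit_mean_mono_set) auto

lemma hit_zero_le_1: "hit_zero x R \<le> 1"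
  unfolding hit_zero_def by (rule order_trans[OF exit_mean_mono exit_mean_one_le]) auto

text \<open>The supremum \<open>G\<close> over all barriers satisfies the first-step inequality for
  visiting 0, so it dominates the probability of such a visit, which is 1.\<close>

lemma hit_zero_limit:
  assumes "0 < e"
  shows "\<exists>R. 1 \<le> hit_zero x R + ennreal e"
proof -
  define G where "G = (\<lambda>x. SUP R. hit_zero x (int R))"
  have "exit_mean (- {0}) (\<lambda>y. 1) x \<le> G x"
  proof (rule exit_mean_least)
    fix x
    let ?s = "\<lambda>R y. if y \<in> {..<int R} - {0} then hit_zero y (int R) else if y = 0 then 1 else 0"
    have mono: "?s R y \<le> ?s S y" if "R \<le> S" for R S y
      using that hit_zero_mono[of "int R" "int S" y] by auto
    have "(if y \<in> - {0} then G y else 1) \<le> (SUP R. ?s R y)" for y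
    proof (cases "y = 0")
      case False
      \<comment> \<open>At a position on or above the barrier \<open>?s\<close> is 0, so the barrier
        is first raised beyond \<open>y\<close>.\<close>
      have "hit_zero y (int R) \<le> (SUP R. ?s R y)" for R
        by (rule order_trans[OF _ SUP_upper[of "max R (nat (y + 1))"]])
          (use False in \<open>auto intro: hit_zero_mono\<close>)
      with False show ?thesis by (auto simp: G_def intro: SUP_least)
    qed simp
    then have "step (\<lambda>y. if y \<in> - {0} then G y else 1) x \<le> step (\<lambda>y. SUP R. ?s R y) x"
      by (intro step_mono)
    also have "\<dots> = (SUP R. step (?s R) x)"
      using mono by (intro step_SUP) (auto simp only: incseq_def)
    also have "\<dots> = G x"
      unfolding G_def hit_zero_def by (intro SUP_cong refl exit_mean_unfold[symmetric])
    finally show "step (\<lambda>y. if y \<in> - {0} then G y else 1) x \<le> G x" .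
  qed
  then have "1 \<le> G x" by (simp add: exit_mean_one_point)
  moreover have "G x \<le> 1" unfolding G_def by (intro SUP_least hit_zero_le_1)
  ultimately have "1 = (SUP R. hit_zero x (int R))" by (simp add: G_def)
  from SUP_approx_ennreal[OF assms _ this] show ?thesis by (auto intro: less_imp_le)
qed

text \<open>A ladder jump of size \<open>k\<close> can overshoot 0 from at most \<open>k\<close>
  levels, so the sum over ladder points is at most \<open>E[Z; Z > l]\<close>, whatever
  \<open>y\<close> is.\<close>

lemma overshoot_tail_le:
  "y < 0 \<Longrightarrow> exit_mean {..<0} (\<lambda>z. if int l < z then 1 else 0) y \<le> tail l"
proof -
  assume y: "y < 0"
  let ?h = "\<lambda>z. if int l < z then 1 else (0 :: ennreal)"
  have "exit_mean {..<0} ?h y \<le> (\<Sum>j\<in>{y..<0}. exit_mean {..0} (\<lambda>k. if 0 \<le> j + k then ?h (j + k) else 0) 0)"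
    by (rule exit_mean_overshoot_le[OF y])
  also have "\<dots> = exit_mean {..0} (\<lambda>k. \<Sum>j\<in>{y..<0}. if 0 \<le> j + k then ?h (j + k) else 0) 0"
    by (simp add: exit_mean_sum)
  also have "\<dots> \<le> tail l"
    unfolding tail_def
  proof (rule exit_mean_mono)
    fix k :: int assume "k \<notin> {..0}"
    then have k: "1 \<le> k" by simp
    let ?J = "{j \<in> {y..<0}. int l < j + k}"
    have "(\<Sum>j\<in>{y..<0}. if 0 \<le> j + k then ?h (j + k) else 0) = (\<Sum>j\<in>?J. 1)"
      by (intro sum.mono_neutral_cong_right) auto
    also have "\<dots> = ennreal (real (card ?J))" by (simp add: ennreal_of_nat_eq_real_of_nat)
    also have "\<dots> \<le> (if int l < k then ennreal (real_of_int k) else 0)"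
    proof (cases "int l < k")
      case True
      have "card ?J \<le> card {-k..<0}" by (intro card_mono) auto
      with True k show ?thesis by (auto intro!: ennreal_leI)
    next
      case False
      then have J: "?J = {}" by auto
      show ?thesis unfolding J by simp
    qed
    finally show "(\<Sum>j\<in>{y..<0}. if 0 \<le> j + k then ?h (j + k) else 0) \<le>
      (if int l < k then ennreal (real_of_int k) else 0)" .
  qed
  finally show ?thesis .
qed

text \<open>Up to probability \<open>e / 2\<close> the walk enters \<open>{0..}\<close> within
  \<open>{0..l}\<close>, uniformly in \<open>y\<close>; for these finitely many points one barrier
  \<open>S\<close> makes a visit to 0 likely enough.\<close>

lemma hit_zero_from_below:
  assumes "0 < e"
  shows "\<exists>S. \<forall>R y. S \<le> R \<and> y < 0 \<longrightarrow> 1 \<le> hit_zero y R + ennreal e"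
proof -
  obtain l where l: "tail l \<le> ennreal (e / 2)" using tail_small[of "e / 2"] assms by auto
  have "\<exists>S. \<forall>k\<in>{1..int l}. 1 \<le> hit_zero k S + ennreal (e / 2)"
  proof -
    have "\<exists>S. 1 \<le> hit_zero k S + ennreal (e / 2)" for k
      using assms by (intro hit_zero_limit) auto
    then obtain s where s: "1 \<le> hit_zero k (s k) + ennreal (e / 2)" for k by metis
    have "1 \<le> hit_zero k (Max (s ` {1..int l})) + ennreal (e / 2)" if "k \<in> {1..int l}" for k
      using that by (intro order_trans[OF s[of k] add_right_mono] hit_zero_mono Max_ge) auto
    then show ?thesis by blast
  qed
  then obtain S where S: "\<And>k. k \<in> {1..int l} \<Longrightarrow> 1 \<le> hit_zero k S + ennreal (e / 2)" by blast
  have "1 \<le> hit_zero y R + ennreal e" if R: "max S (int l + 1) \<le> R" and y: "y < 0" for R y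
  proof -
    let ?A = "{..<R} - {0}"
    let ?g = "\<lambda>z. if z \<in> ?A then hit_zero z R else if z = 0 then 1 else 0"
    have "1 = exit_mean {..<0} (\<lambda>z. 1) y" by (simp add: exit_mean_one[of 0])
    also have "\<dots> \<le> exit_mean {..<0} (\<lambda>z. ?g z + (ennreal (e / 2) + (if int l < z then 1 else 0))) y"
    proof (rule exit_mean_mono)
      fix z :: int assume "z \<notin> {..<0}"
      then consider "z = 0" | "z \<in> {1..int l}" | "int l < z" by force
      then show "1 \<le> ?g z + (ennreal (e / 2) + (if int l < z then 1 else 0))"
      proof cases
        case 2
        have "1 \<le> hit_zero z S + ennreal (e / 2)" by (rule S[OF 2])
        also have "\<dots> \<le> hit_zero z R + ennreal (e / 2)"
          using R by (intro add_right_mono hit_zero_mono) auto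
        finally show ?thesis using 2 R by auto
      qed (auto simp: add_increasing add_increasing2)
    qed
    also have "\<dots> = exit_mean {..<0} ?g y + (ennreal (e / 2) + exit_mean {..<0} (\<lambda>z. if int l < z then 1 else 0) y)"
      by (simp only: exit_mean_add exit_mean_const[of 0 "{..<0}"] lessThan_iff less_irrefl not_False_eq_True)
    also have "exit_mean {..<0} ?g y = hit_zero y R"
      unfolding hit_zero_def using R by (intro exit_mean_strong_Markov[symmetric]) auto
    also have "hit_zero y R + (ennreal (e / 2) + exit_mean {..<0} (\<lambda>z. if int l < z then 1 else 0) y) \<le>
        hit_zero y R + (ennreal (e / 2) + ennreal (e / 2))"
      by (intro add_left_mono order_trans[OF overshoot_tail_le[OF y] l])
    also have "ennreal (e / 2) + ennreal (e / 2) = ennreal e"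
      using assms by (simp add: ennreal_plus[symmetric] del: ennreal_plus)
    finally show ?thesis .
  qed
  then show ?thesis by (intro exI[of _ "max S (int l + 1)"]) auto
qed

text \<open>A visit to 0 before the barrier requires a lower exit from \<open>(0, R)\<close>; after
  a lower exit the visit fails with probability at most \<open>e\<close>. The error is thus
  proportional to \<open>hit_below\<close>, as needed for a ratio.\<close>

lemma hit_zero_asymptotics:
  assumes "0 < e"
  shows "\<exists>S. \<forall>R x. S \<le> R \<longrightarrow> hit_zero x R \<le> hit_below x R \<and>
    hit_below x R \<le> hit_zero x R + ennreal e * hit_below x R"
proof -
  obtain S where S: "\<And>R y. S \<le> R \<Longrightarrow> y < 0 \<Longrightarrow> 1 \<le> hit_zero y R + ennreal e"
    using hit_zero_from_below[OF assms] by blast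
  have "hit_zero x R \<le> hit_below x R \<and> hit_below x R \<le> hit_zero x R + ennreal e * hit_below x R"
    if R: "max S 1 \<le> R" for x R
  proof -
    let ?A = "{..<R} - {0}"
    let ?g = "\<lambda>z. if z \<in> ?A then hit_zero z R else if z = 0 then 1 else 0"
    have eq: "hit_zero x R = exit_mean {1..<R} ?g x"
      unfolding hit_zero_def by (intro exit_mean_strong_Markov) auto
    have "hit_zero x R \<le> hit_below x R"
      unfolding eq hit_below_def by (intro exit_mean_mono) (use R hit_zero_le_1 in auto)
    moreover have "hit_below x R \<le> exit_mean {1..<R} (\<lambda>y. ?g y + ennreal e * (if y \<le> 0 then 1 else 0)) x"
      unfolding hit_below_def
      by (intro exit_mean_mono) (use R S[of R] in \<open>auto simp: add_increasing2\<close>)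
    then have "hit_below x R \<le> hit_zero x R + ennreal e * hit_below x R"
      unfolding exit_mean_add exit_mean_cmult eq[symmetric] hit_below_def[symmetric] .
    ultimately show ?thesis by blast
  qed
  then show ?thesis by blast
qed

end

section \<open>Random walks on a probability space\<close>

lemma hitting_time_eq:
  "hitting_time B s = (if \<exists>n\<ge>1. s n \<in> B then enat (LEAST n. 1 \<le> n \<and> s n \<in> B) else \<infinity>)"
proof (cases "\<exists>n\<ge>1. s n \<in> B")
  case True
  then have L: "1 \<le> (LEAST n. 1 \<le> n \<and> s n \<in> B) \<and> s (LEAST n. 1 \<le> n \<and> s n \<in> B) \<in> B"
    by (rule_tac LeastI_ex) blast
  have "hitting_time B s = enat (LEAST n. 1 \<le> n \<and> s n \<in> B)"
    unfolding hitting_time_def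
    by (intro antisym INF_lower INF_greatest) (use L in \<open>auto intro: Least_le\<close>)
  with True show ?thesis by simp
next
  case False
  then have *: "{n. 1 \<le> n \<and> s n \<in> B} = {}" by auto
  show ?thesis unfolding hitting_time_def * using False by (auto simp: top_enat_def)
qed

lemma hitting_time_eq_enat_iff:
  "hitting_time B s = enat n \<longleftrightarrow> 1 \<le> n \<and> s n \<in> B \<and> (\<forall>m. 1 \<le> m \<and> m < n \<longrightarrow> s m \<notin> B)" (is "?L \<longleftrightarrow> ?R")
proof
  assume ?L
  then have ex: "\<exists>n\<ge>1. s n \<in> B" and n: "n = (LEAST n. 1 \<le> n \<and> s n \<in> B)"
    by (auto simp: hitting_time_eq split: if_splits)
  from ex have "1 \<le> n \<and> s n \<in> B" unfolding n by (rule_tac LeastI_ex) blast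
  moreover have "s m \<notin> B" if "1 \<le> m" "m < n" for m
    using not_less_Least[of m "\<lambda>n. 1 \<le> n \<and> s n \<in> B"] that unfolding n by blast
  ultimately show ?R by blast
next
  assume R: ?R
  then have "(LEAST n. 1 \<le> n \<and> s n \<in> B) = n"
    by (intro Least_equality) (auto simp: not_less[symmetric])
  with R show ?L by (auto simp: hitting_time_eq)
qed

lemma hitting_time_cases:
  obtains (finite) n where "hitting_time B s = enat n" "1 \<le> n" "s n \<in> B" "\<And>m. 1 \<le> m \<Longrightarrow> m < n \<Longrightarrow> s m \<notin> B"
  | (infinite) "hitting_time B s = \<infinity>" "\<And>n. 1 \<le> n \<Longrightarrow> s n \<notin> B"
proof (cases "hitting_time B s")
  case (enat n)
  then show ?thesis using hitting_time_eq_enat_iff[of B s n] by (intro finite) auto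
next
  case infinity
  then show ?thesis by (intro infinite) (auto simp: hitting_time_eq split: if_splits)
qed

text \<open>The race between disjoint sets is decided by the point at which their union is first
  entered. Finiteness is stated separately because \<open>value_at\<close> has a default value at
  time infinity.\<close>

lemma hitting_time_less_iff:
  assumes "B \<inter> C = {}"
  shows "hitting_time B s < hitting_time C s \<longleftrightarrow>
    hitting_time (B \<union> C) s < \<infinity> \<and> value_at s (hitting_time (B \<union> C) s) \<in> B"
proof (cases rule: hitting_time_cases[of "B \<union> C" s])
  case (finite n)
  show ?thesis
  proof (cases "s n \<in> B")
    case True
    have B: "hitting_time B s = enat n" using finite True by (auto simp: hitting_time_eq_enat_iff)
    have "enat n < hitting_time C s"
    proof (cases rule: hitting_time_cases[of C s])
      case f: (finite m)
      have "m \<noteq> n" using f True assms by auto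
      moreover have "\<not> m < n" using f finite(4)[of m] by auto
      ultimately show ?thesis using f by simp
    qed simp
    with True B finite show ?thesis by (simp add: value_at_def)
  next
    case False
    then have "s n \<in> C" using finite by auto
    then have C: "hitting_time C s = enat n" using finite by (auto simp: hitting_time_eq_enat_iff)
    have "\<not> hitting_time B s < enat n"
    proof (cases rule: hitting_time_cases[of B s])
      case f: (finite m)
      have "\<not> m < n" using f finite(4)[of m] by auto
      then show ?thesis using f by simp
    qed simp
    with False C finite show ?thesis by (simp add: value_at_def)
  qed
next
  case infinite
  then have "hitting_time B s = \<infinity>" "hitting_time C s = \<infinity>"
    by (auto simp: hitting_time_eq)
  with infinite show ?thesis by simp
qed

lemma measurable_add_int [measurable (raw)]:
  fixes f g :: "'a \<Rightarrow> int"
  assumes f: "f \<in> M \<rightarrow>\<^sub>M count_space UNIV" and g: "g \<in> M \<rightarrow>\<^sub>M count_space UNIV"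
  shows "(\<lambda>w. f w + g w) \<in> M \<rightarrow>\<^sub>M count_space UNIV"
proof (rule measurable_compose_countable[OF _ g])
  fix i :: int
  show "(\<lambda>w. f w + i) \<in> M \<rightarrow>\<^sub>M count_space UNIV"
    by (rule measurable_compose[OF f]) simp
qed

lemma measurable_sum_int:
  fixes f :: "'i \<Rightarrow> 'a \<Rightarrow> int"
  assumes "finite I" "\<And>i. i \<in> I \<Longrightarrow> f i \<in> M \<rightarrow>\<^sub>M count_space UNIV"
  shows "(\<lambda>w. \<Sum>i\<in>I. f i w) \<in> M \<rightarrow>\<^sub>M count_space UNIV"
  using assms by (induction I rule: finite_induct) (auto intro!: measurable_add_int)

section \<open>Exit distributions of the random walk\<close>

locale iid_walk = prob_space M for M :: "'a measure" +
  fixes X :: "nat \<Rightarrow> 'a \<Rightarrow> int"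
  assumes iid: "iid_steps M X"
begin

definition step_law :: "int pmf" where
  "step_law = embed_pmf (\<lambda>a. prob {\<omega> \<in> space M. X 1 \<omega> = a})"

sublocale int_walk step_law .

lemma measurable_X: "1 \<le> n \<Longrightarrow> X n \<in> M \<rightarrow>\<^sub>M count_space UNIV"
  using iid unfolding iid_steps_def indep_vars_def by auto

lemma pmf_step_law: "pmf step_law a = prob {\<omega> \<in> space M. X 1 \<omega> = a}"
  unfolding step_law_def
proof (rule pmf_embed_pmf)
  have [measurable]: "X 1 \<in> M \<rightarrow>\<^sub>M count_space UNIV" by (rule measurable_X) simp
  have "(\<integral>\<^sup>+ a. ennreal (prob {\<omega> \<in> space M. X 1 \<omega> = a}) \<partial>count_space UNIV) =
      (\<integral>\<^sup>+ a. \<integral>\<^sup>+ \<omega>. indicator {X 1 \<omega>} a \<partial>M \<partial>count_space UNIV)"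
  proof (intro nn_integral_cong)
    fix a
    have S: "{\<omega> \<in> space M. X 1 \<omega> = a} \<in> sets M" by measurable
    have "(\<integral>\<^sup>+ \<omega>. indicator {X 1 \<omega>} a \<partial>M) = (\<integral>\<^sup>+ \<omega>. indicator {\<omega> \<in> space M. X 1 \<omega> = a} \<omega> \<partial>M)"
      by (intro nn_integral_cong) (auto simp: indicator_def)
    then show "ennreal (prob {\<omega> \<in> space M. X 1 \<omega> = a}) = (\<integral>\<^sup>+ \<omega>. indicator {X 1 \<omega>} a \<partial>M)"
      by (simp only: nn_integral_indicator[OF S] emeasure_eq_measure)
  qed
  also have "\<dots> = (\<integral>\<^sup>+ \<omega>. \<integral>\<^sup>+ a. indicator {X 1 \<omega>} a \<partial>count_space UNIV \<partial>M)"
  proof (rule nn_integral_count_space_nn_integral[symmetric])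
    fix a
    have "(\<lambda>x. indicator {\<omega> \<in> space M. X 1 \<omega> = a} x :: ennreal) \<in> borel_measurable M" by measurable
    then show "(\<lambda>x. indicator {X 1 x} a :: ennreal) \<in> borel_measurable M"
      by (rule measurable_cong[THEN iffD1, rotated]) (auto simp: indicator_def)
  qed auto
  also have "\<dots> = 1" by (simp add: one_ennreal_def[symmetric] emeasure_space_1)
  finally show "(\<integral>\<^sup>+ a. ennreal (prob {\<omega> \<in> space M. X 1 \<omega> = a}) \<partial>count_space UNIV) = 1" .
qed simp

lemma prob_X:
  assumes "1 \<le> n"
  shows "prob (X n -` {a} \<inter> space M) = pmf step_law a"
proof -
  have "distr M (count_space UNIV) (X n) = distr M (count_space UNIV) (X 1)"
    using iid assms unfolding iid_steps_def by blast
  then have "measure (distr M (count_space UNIV) (X n)) {a} = measure (distr M (count_space UNIV) (X 1)) {a}"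
    by simp
  then have "prob (X n -` {a} \<inter> space M) = prob (X 1 -` {a} \<inter> space M)"
    using measurable_X[OF assms] measurable_X[of 1] by (simp add: measure_distr)
  also have "X 1 -` {a} \<inter> space M = {\<omega> \<in> space M. X 1 \<omega> = a}" by auto
  finally show ?thesis by (simp add: pmf_step_law)
qed

definition initial_steps :: "'a \<Rightarrow> nat \<Rightarrow> int list" where
  "initial_steps \<omega> n = map (\<lambda>i. X i \<omega>) [1..<Suc n]"

lemma length_initial_steps [simp]: "length (initial_steps \<omega> n) = n"
  by (simp add: initial_steps_def)

lemma take_initial_steps: "i \<le> n \<Longrightarrow> take i (initial_steps \<omega> n) = initial_steps \<omega> i"
  unfolding initial_steps_def take_map by (simp add: take_upt del: upt_Suc)

lemma walk_initial_steps: "walk X x \<omega> n = x + sum_list (initial_steps \<omega> n)"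
  unfolding walk_def initial_steps_def
  by (simp add: interv_sum_list_conv_sum_set_nat atLeastLessThanSuc_atLeastAtMost del: upt_Suc)

lemma weight_prod: "weight as = (\<Prod>i<length as. ennreal (pmf step_law (as ! i)))"
  by (induction as) (simp_all add: prod.lessThan_Suc_shift del: prod.lessThan_Suc)

lemma initial_steps_iff:
  "initial_steps \<omega> (length as) = as \<longleftrightarrow> (\<forall>i\<in>{1..length as}. X i \<omega> = as ! (i - 1))"
proof -
  have "initial_steps \<omega> (length as) = as \<longleftrightarrow> (\<forall>i<length as. X (Suc i) \<omega> = as ! i)"
    unfolding list_eq_iff_nth_eq initial_steps_def by (simp del: upt_Suc)
  also have "\<dots> \<longleftrightarrow> (\<forall>i\<in>{1..length as}. X i \<omega> = as ! (i - 1))"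
  proof safe
    fix i assume "\<forall>i<length as. X (Suc i) \<omega> = as ! i" "i \<in> {1..length as}"
    then show "X i \<omega> = as ! (i - 1)" by (cases i) auto
  next
    fix i assume "\<forall>i\<in>{1..length as}. X i \<omega> = as ! (i - 1)" "i < length as"
    then show "X (Suc i) \<omega> = as ! i" by (auto dest!: bspec[of _ _ "Suc i"])
  qed
  finally show ?thesis .
qed

lemma emeasure_initial_steps:
  "{\<omega> \<in> space M. initial_steps \<omega> (length as) = as} \<in> sets M"
  "emeasure M {\<omega> \<in> space M. initial_steps \<omega> (length as) = as} = weight as"
proof -
  let ?J = "{1..length as}"
  have eq: "{\<omega> \<in> space M. initial_steps \<omega> (length as) = as} =
      (\<Inter>i\<in>?J. X i -` {as ! (i - 1)} \<inter> space M)" if "as \<noteq> []"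
    unfolding initial_steps_iff using that by (cases as) auto
  \<comment> \<open>Independence is applied to nonempty index sets, so the empty list is treated
    apart.\<close>
  have nil: "{\<omega> \<in> space M. initial_steps \<omega> (length as) = as} = space M" if "as = []"
    using that by (auto simp: initial_steps_def)
  show "{\<omega> \<in> space M. initial_steps \<omega> (length as) = as} \<in> sets M"
  proof (cases "as = []")
    case False
    then show ?thesis unfolding eq[OF False]
      by (intro sets.finite_INT) (auto simp: Suc_le_eq intro!: measurable_sets[OF measurable_X])
  next
    case True
    then show ?thesis unfolding nil[OF True] by simp
  qed
  show "emeasure M {\<omega> \<in> space M. initial_steps \<omega> (length as) = as} = weight as"
  proof (cases "as = []")
    case False
    have "prob (\<Inter>i\<in>?J. X i -` {as ! (i - 1)} \<inter> space M) =
        (\<Prod>i\<in>?J. prob (X i -` {as ! (i - 1)} \<inter> space M))"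
      using False iid unfolding iid_steps_def by (intro indep_varsD) (auto simp: Suc_le_eq)
    also have "\<dots> = (\<Prod>i\<in>?J. pmf step_law (as ! (i - 1)))"
      by (intro prod.cong prob_X) auto
    also have "\<dots> = (\<Prod>i<length as. pmf step_law (as ! i))"
      by (rule prod.reindex_bij_witness[of _ Suc "\<lambda>i. i - 1"]) auto
    finally show ?thesis
      unfolding eq[OF False] weight_prod by (simp add: emeasure_eq_measure prod_ennreal)
  next
    case True
    then show ?thesis unfolding nil[OF True] by (simp add: emeasure_space_1)
  qed
qed

lemma measurable_walk: "(\<lambda>\<omega>. walk X x \<omega> n) \<in> M \<rightarrow>\<^sub>M count_space UNIV"
  unfolding walk_def by (intro measurable_add_int measurable_sum_int measurable_X) auto

lemma measurable_walk_in: "{\<omega> \<in> space M. walk X x \<omega> n \<in> B} \<in> sets M"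
proof -
  have "(\<lambda>\<omega>. walk X x \<omega> n) -` B \<inter> space M \<in> sets M"
    by (rule measurable_sets[OF measurable_walk]) simp
  then show ?thesis by (simp add: vimage_def Int_def conj_commute)
qed

lemma measurable_hitting_time:
  "(\<lambda>\<omega>. hitting_time B (walk X x \<omega>)) \<in> M \<rightarrow>\<^sub>M count_space UNIV"
proof -
  note [measurable] = measurable_walk_in
  have "{\<omega> \<in> space M. hitting_time B (walk X x \<omega>) = t} \<in> sets M" for t
  proof (cases t)
    case (enat n)
    show ?thesis unfolding enat hitting_time_eq_enat_iff by measurable
  next
    case infinity
    have "{\<omega> \<in> space M. hitting_time B (walk X x \<omega>) = t} =
        {\<omega> \<in> space M. \<forall>n. 1 \<le> n \<longrightarrow> \<not> walk X x \<omega> n \<in> B}"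
      by (auto simp: infinity hitting_time_eq)
    also have "\<dots> \<in> sets M" by measurable
    finally show ?thesis .
  qed
  then show ?thesis
    unfolding measurable_count_space_eq2_countable by (simp add: vimage_def Int_def conj_commute)
qed

lemma measurable_value_at_hitting_time:
  "(\<lambda>\<omega>. value_at (walk X x \<omega>) (hitting_time B (walk X x \<omega>))) \<in> M \<rightarrow>\<^sub>M count_space UNIV"
proof (rule measurable_compose_countable[OF _ measurable_hitting_time])
  fix t :: enat
  show "(\<lambda>\<omega>. value_at (walk X x \<omega>) t) \<in> M \<rightarrow>\<^sub>M count_space UNIV"
    unfolding value_at_def by (cases t) (auto intro: measurable_walk)
qed

lemma exit_path_initial_steps:
  "exit_path A x (initial_steps \<omega> n) \<longleftrightarrow> hitting_time (- A) (walk X x \<omega>) = enat n"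
proof -
  have "initial_steps \<omega> n \<noteq> [] \<longleftrightarrow> 1 \<le> n"
    using length_initial_steps[of \<omega> n] by (metis One_nat_def Suc_le_eq length_greater_0_conv)
  then show ?thesis
    unfolding exit_path_iff hitting_time_eq_enat_iff by (auto simp: take_initial_steps walk_initial_steps)
qed

text \<open>Transfers path sums to the probability space: a trajectory that leaves \<open>A\<close>
  does so along exactly one list of steps, and that list has probability \<open>weight\<close>; the
  expectation becomes a sum over lists.\<close>

lemma nn_integral_exit:
  "(\<integral>\<^sup>+ \<omega>. (if hitting_time (- A) (walk X x \<omega>) < \<infinity>
      then h (value_at (walk X x \<omega>) (hitting_time (- A) (walk X x \<omega>))) else 0) \<partial>M) = exit_mean A h x"
proof -
  let ?t = "\<lambda>\<omega>. hitting_time (- A) (walk X x \<omega>)"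
  let ?E = "\<lambda>as. {\<omega> \<in> space M. initial_steps \<omega> (length as) = as}"
  let ?g = "\<lambda>as \<omega>. (if exit_path A x as then h (x + sum_list as) else 0) * indicator (?E as) \<omega>"
  have "(\<integral>\<^sup>+ \<omega>. (if ?t \<omega> < \<infinity> then h (value_at (walk X x \<omega>) (?t \<omega>)) else 0) \<partial>M) =
      (\<integral>\<^sup>+ \<omega>. \<integral>\<^sup>+ as. ?g as \<omega> \<partial>count_space UNIV \<partial>M)"
  proof (intro nn_integral_cong)
    fix \<omega> assume \<omega>: "\<omega> \<in> space M"
    show "(if ?t \<omega> < \<infinity> then h (value_at (walk X x \<omega>) (?t \<omega>)) else 0) = (\<integral>\<^sup>+ as. ?g as \<omega> \<partial>count_space UNIV)"
    proof (cases "?t \<omega>")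
      case (enat n)
      have "(\<integral>\<^sup>+ as. ?g as \<omega> \<partial>count_space UNIV) = (\<Sum>as\<in>{initial_steps \<omega> n}. ?g as \<omega>)"
      proof (rule nn_integral_count_space')
        fix as assume "as \<notin> {initial_steps \<omega> n}"
        then show "?g as \<omega> = 0"
          using exit_path_initial_steps[of A x \<omega> "length as"] enat by (auto simp: indicator_def)
      qed auto
      also have "\<dots> = h (walk X x \<omega> n)"
        using \<omega> exit_path_initial_steps[of A x \<omega> n] enat by (simp add: walk_initial_steps)
      finally show ?thesis using enat by (simp add: value_at_def)
    next
      case infinity
      have z: "?g as \<omega> = 0" for as
        using exit_path_initial_steps[of A x \<omega> "length as"] infinity by (auto simp: indicator_def)
      show ?thesis unfolding z using infinity by simp
    qed
  qed
  also have "\<dots> = (\<integral>\<^sup>+ as. \<integral>\<^sup>+ \<omega>. ?g as \<omega> \<partial>M \<partial>count_space UNIV)"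
    using emeasure_initial_steps(1) by (intro nn_integral_count_space_nn_integral) auto
  also have "\<dots> = exit_mean A h x"
    unfolding exit_mean_def using emeasure_initial_steps
    by (intro nn_integral_cong) (simp add: nn_integral_cmult_indicator mult.commute)
  finally show ?thesis .
qed

lemma sets_hitting_time: "{\<omega> \<in> space M. P (hitting_time B (walk X x \<omega>)) (value_at (walk X x \<omega>) (hitting_time B (walk X x \<omega>)))} \<in> sets M"
proof -
  have "{\<omega> \<in> space M. (\<lambda>\<omega>. case (hitting_time B (walk X x \<omega>), value_at (walk X x \<omega>) (hitting_time B (walk X x \<omega>))) of (t, v) \<Rightarrow> P t v) \<omega>} \<in> sets M"
  proof -
    have "(\<lambda>\<omega>. P (hitting_time B (walk X x \<omega>)) (value_at (walk X x \<omega>) (hitting_time B (walk X x \<omega>)))) \<in> M \<rightarrow>\<^sub>M count_space UNIV"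
      by (rule measurable_compose_countable[OF _ measurable_hitting_time],
          rule measurable_compose[OF measurable_value_at_hitting_time]) simp
    then show ?thesis by (simp add: pred_def)
  qed
  then show ?thesis by simp
qed

lemma emeasure_exit:
  "emeasure M {\<omega> \<in> space M. hitting_time (- A) (walk X x \<omega>) < \<infinity> \<and>
     value_at (walk X x \<omega>) (hitting_time (- A) (walk X x \<omega>)) \<in> B} =
   exit_mean A (\<lambda>y. if y \<in> B then 1 else 0) x" (is "emeasure M ?S = _")
proof -
  have "?S \<in> sets M" by (rule sets_hitting_time)
  then have "emeasure M ?S = (\<integral>\<^sup>+ \<omega>. indicator ?S \<omega> \<partial>M)" by simp
  also have "\<dots> = (\<integral>\<^sup>+ \<omega>. (if hitting_time (- A) (walk X x \<omega>) < \<infinity>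
      then (if value_at (walk X x \<omega>) (hitting_time (- A) (walk X x \<omega>)) \<in> B then 1 else 0) else 0) \<partial>M)"
    by (intro nn_integral_cong) (auto simp: indicator_def)
  also have "\<dots> = exit_mean A (\<lambda>y. if y \<in> B then 1 else 0) x"
    by (rule nn_integral_exit)
  finally show ?thesis .
qed

lemma prob_hitting_time_less:
  assumes "B \<inter> C = {}" "A = - (B \<union> C)"
  shows "prob {\<omega> \<in> space M. hitting_time B (walk X x \<omega>) < hitting_time C (walk X x \<omega>)} =
    enn2real (exit_mean A (\<lambda>y. if y \<in> B then 1 else 0) x)"
  unfolding hitting_time_less_iff[OF assms(1)] emeasure_exit[symmetric] assms(2) by (simp add: measure_def)

lemma emeasure_hitting_time_finite:
  "emeasure M {\<omega> \<in> space M. hitting_time (- A) (walk X x \<omega>) < \<infinity>} = exit_mean A (\<lambda>y. 1) x"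
  using emeasure_exit[of A x UNIV] by simp

lemma AE_hitting_time_finite:
  assumes "exit_mean A (\<lambda>y. 1) x = 1"
  shows "AE \<omega> in M. hitting_time (- A) (walk X x \<omega>) < \<infinity>"
proof -
  let ?S = "{\<omega> \<in> space M. hitting_time (- A) (walk X x \<omega>) < \<infinity>}"
  have "prob ?S = 1" using emeasure_hitting_time_finite[of A x] assms by (simp add: measure_def)
  moreover have "?S \<in> sets M" by (rule sets_hitting_time)
  ultimately have "AE \<omega> in M. \<omega> \<in> ?S" using prob_eq_1 by blast
  then show ?thesis by (rule AE_mp) simp
qed

end

section \<open>The renewal function as a harmonic function\<close>

locale finite_mean_iid_walk = iid_walk +
  assumes irreducible_walk: "irreducible_walk M X"
    and recurrent_walk: "recurrent_walk M X"
    and integrable_height: "integrable M (\<lambda>\<omega>. real_of_int (strict_ascending_height X \<omega>))"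

lemma strict_ascending_height_eq:
  "strict_ascending_height X \<omega> = value_at (walk X 0 \<omega>) (hitting_time (- {..0}) (walk X 0 \<omega>))"
proof -
  have "{1..} = - {..0 :: int}" by auto
  then show ?thesis by (simp add: strict_ascending_height_def walk_def Let_def)
qed

lemma weak_descending_height_eq:
  "weak_descending_height X \<omega> = - value_at (walk X 0 \<omega>) (hitting_time (- {1..}) (walk X 0 \<omega>))"
proof -
  have "{..0} = - {1 :: int..}" by auto
  then show ?thesis by (simp add: weak_descending_height_def walk_def Let_def)
qed

sublocale finite_mean_iid_walk \<subseteq> finite_mean_walk step_law
proof
  have "- (- {0}) = {0 :: int}" by simp
  then have "emeasure M {\<omega> \<in> space M. hitting_time {0} (walk X 0 \<omega>) < \<infinity>} = exit_mean (- {0}) (\<lambda>y. 1) 0"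
    using emeasure_hitting_time_finite[of "- {0}" 0] by simp
  then show "exit_mean (- {0}) (\<lambda>y. 1) 0 = 1"
    using recurrent_walk by (simp add: recurrent_walk_def emeasure_eq_measure)
next
  fix y
  obtain n where n: "0 < prob {\<omega> \<in> space M. walk X 0 \<omega> n = y}"
    using irreducible_walk by (auto simp: irreducible_walk_def)
  show "\<exists>as. 0 < weight as \<and> sum_list as = y"
  proof (rule ccontr)
    assume "\<nexists>as. 0 < weight as \<and> sum_list as = y"
    then have w: "weight as = 0" if "sum_list as = y" for as
      using that by (auto simp: zero_less_iff_neq_zero)
    let ?E = "\<lambda>as. {\<omega> \<in> space M. initial_steps \<omega> (length as) = as}"
    \<comment> \<open>There are countably many step lists; if all those with total \<open>y\<close>
      had weight 0, the event \<open>S_n = y\<close> would be null.\<close>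
    have U: "(\<Union>as\<in>{as. sum_list as = y}. ?E as) \<in> null_sets M"
      by (intro null_sets_UN') (auto simp: null_sets_def emeasure_initial_steps w)
    have "{\<omega> \<in> space M. walk X 0 \<omega> n = y} \<subseteq> (\<Union>as\<in>{as. sum_list as = y}. ?E as)"
      by (auto simp: walk_initial_steps intro!: bexI[of _ "initial_steps _ n"])
    then have "emeasure M {\<omega> \<in> space M. walk X 0 \<omega> n = y} \<le> emeasure M (\<Union>as\<in>{as. sum_list as = y}. ?E as)"
      using U by (intro emeasure_mono) auto
    then have "emeasure M {\<omega> \<in> space M. walk X 0 \<omega> n = y} \<le> 0" using U by auto
    then show False using n by (simp add: emeasure_eq_measure)
  qed
next
  have "exit_mean {..0} (\<lambda>y. ennreal (real_of_int y)) 0 \<le>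
      (\<integral>\<^sup>+ \<omega>. ennreal (real_of_int (strict_ascending_height X \<omega>)) \<partial>M)"
    unfolding nn_integral_exit[symmetric] strict_ascending_height_eq
    by (intro nn_integral_mono) auto
  also have "\<dots> \<le> (\<integral>\<^sup>+ \<omega>. ennreal (norm (real_of_int (strict_ascending_height X \<omega>))) \<partial>M)"
    by (intro nn_integral_mono ennreal_leI) auto
  also have "\<dots> < \<infinity>"
    using integrable_height unfolding integrable_iff_bounded by simp
  finally show "exit_mean {..0} (\<lambda>y. ennreal (real_of_int y)) 0 < \<infinity>" .
qed

section \<open>Identification of \<open>V_ds\<close> and \<open>f_r\<close>\<close>

context finite_mean_iid_walk
begin

text \<open>At an infinite ladder time the default of \<open>value_at\<close> gives height 0, so a
  positive height means exactly that the ladder time is finite. This yields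
  \<open>f_r(0) = 1\<close>.\<close>

lemma prob_strict_ascending_height_pos:
  "prob {\<omega> \<in> space M. 0 < strict_ascending_height X \<omega>} = 1"
proof -
  have "0 < strict_ascending_height X \<omega> \<longleftrightarrow> hitting_time (- {..0}) (walk X 0 \<omega>) < \<infinity>" for \<omega>
    unfolding strict_ascending_height_eq
    by (cases rule: hitting_time_cases[of "- {..0}" "walk X 0 \<omega>"])
      (auto simp: value_at_def walk_def)
  then have "emeasure M {\<omega> \<in> space M. 0 < strict_ascending_height X \<omega>} = 1"
    using emeasure_hitting_time_finite[of "{..0}" 0] by (simp add: exit_mean_one[of 1])
  then show ?thesis by (simp add: measure_def)
qed

definition descending_law :: "int measure" where
  "descending_law = distr M (count_space UNIV) (weak_descending_height X)"

lemma measurable_weak_descending_height: "weak_descending_height X \<in> M \<rightarrow>\<^sub>M count_space UNIV"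
proof -
  have "(\<lambda>\<omega>. - value_at (walk X 0 \<omega>) (hitting_time (- {1..}) (walk X 0 \<omega>))) \<in> M \<rightarrow>\<^sub>M count_space UNIV"
    by (rule measurable_compose[OF measurable_value_at_hitting_time]) simp
  then show ?thesis unfolding weak_descending_height_eq[abs_def] .
qed

text \<open>The ladder time is almost surely finite, so the default of \<open>value_at\<close>
  carries no mass; the sign appears because the height is minus the exit position.\<close>

lemma nn_integral_descending_law:
  "(\<integral>\<^sup>+ y. g y \<partial>descending_law) = exit_mean {1..} (\<lambda>y. g (- y)) 0"
proof -
  have "(\<integral>\<^sup>+ y. g y \<partial>descending_law) = (\<integral>\<^sup>+ \<omega>. g (weak_descending_height X \<omega>) \<partial>M)"
    unfolding descending_law_def by (rule nn_integral_distr[OF measurable_weak_descending_height]) simp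
  also have "\<dots> = (\<integral>\<^sup>+ \<omega>. (if hitting_time (- {1..}) (walk X 0 \<omega>) < \<infinity>
      then g (- value_at (walk X 0 \<omega>) (hitting_time (- {1..}) (walk X 0 \<omega>))) else 0) \<partial>M)"
    using AE_hitting_time_finite[OF exit_mean_one[of 0 "{1..}" 0]]
    by (intro nn_integral_cong_AE) (auto simp: weak_descending_height_eq)
  also have "\<dots> = exit_mean {1..} (\<lambda>y. g (- y)) 0"
    by (rule nn_integral_exit)
  finally show ?thesis .
qed

interpretation D: prob_space descending_law
  unfolding descending_law_def by (rule prob_space_distr[OF measurable_weak_descending_height])

interpretation DP: product_prob_space "\<lambda>_ :: nat. descending_law" UNIV ..

text \<open>The case \<open>k = 0\<close> is included so that the summand 1 of \<open>V_ds\<close>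
  becomes the term of index 0.\<close>

definition height_sum :: "nat \<Rightarrow> int \<Rightarrow> ennreal" where
  "height_sum k x = emeasure (\<Pi>\<^sub>M i\<in>{1..k}. descending_law)
     {\<zeta> \<in> space (\<Pi>\<^sub>M i\<in>{1..k}. descending_law). (\<Sum>i=1..k. \<zeta> i) \<le> x}"

lemma sets_height_sum:
  fixes I :: "nat set"
  assumes "finite I"
  shows "{\<zeta> \<in> space (\<Pi>\<^sub>M i\<in>I. descending_law). (\<Sum>i\<in>I. \<zeta> i) \<le> x} \<in> sets (\<Pi>\<^sub>M i\<in>I. descending_law)"
proof -
  have "(\<lambda>\<zeta>. \<Sum>i\<in>I. \<zeta> i) \<in> (\<Pi>\<^sub>M i\<in>I. descending_law) \<rightarrow>\<^sub>M count_space UNIV"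
  proof (rule measurable_sum_int[OF assms])
    fix i assume "i \<in> I"
    then have "(\<lambda>\<zeta>. \<zeta> i) \<in> (\<Pi>\<^sub>M i\<in>I. descending_law) \<rightarrow>\<^sub>M descending_law"
      by (rule measurable_component_singleton)
    then show "(\<lambda>\<zeta>. \<zeta> i) \<in> (\<Pi>\<^sub>M i\<in>I. descending_law) \<rightarrow>\<^sub>M count_space UNIV"
      by (simp add: descending_law_def)
  qed
  from measurable_sets[OF this, of "{..x}"] show ?thesis
    by (simp add: vimage_def Int_def conj_commute)
qed

lemma height_sum_0: "height_sum 0 x = (if 0 \<le> x then 1 else 0)"
  by (simp add: height_sum_def PiM_empty emeasure_count_space)

text \<open>Conditioning on the coordinate \<open>Suc k\<close>, whose law is that of minus the exit
  position from \<open>{1..}\<close>, leaves the level \<open>x + y\<close> for the other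
  copies.\<close>

lemma height_sum_Suc: "height_sum (Suc k) x = exit_mean {1..} (\<lambda>y. height_sum k (x + y)) 0"
proof -
  have I: "{1..Suc k} = insert (Suc k) {1..k}" and notin: "Suc k \<notin> {1..k}" by auto
  let ?E = "\<lambda>(k :: nat) (x :: int). {\<zeta> \<in> space (\<Pi>\<^sub>M i\<in>{1..k}. descending_law). (\<Sum>i=1..k. \<zeta> i) \<le> x}"
  let ?f = "indicator (?E (Suc k) x) :: _ \<Rightarrow> ennreal"
  have S: "?E k x \<in> sets (\<Pi>\<^sub>M i\<in>{1..k}. descending_law)" for k x by (rule sets_height_sum) simp
  have f: "?f \<in> borel_measurable (\<Pi>\<^sub>M i\<in>insert (Suc k) {1..k}. descending_law)"
    using S[of "Suc k" x] unfolding I[symmetric] by (intro borel_measurable_indicator)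
  have "height_sum (Suc k) x = (\<integral>\<^sup>+ \<zeta>. ?f \<zeta> \<partial>(\<Pi>\<^sub>M i\<in>{1..Suc k}. descending_law))"
    unfolding height_sum_def using S[of "Suc k" x] by simp
  also have "\<dots> = (\<integral>\<^sup>+ y. \<integral>\<^sup>+ \<zeta>. ?f (\<zeta>(Suc k := y)) \<partial>(\<Pi>\<^sub>M i\<in>{1..k}. descending_law) \<partial>descending_law)"
    by (rule DP.product_nn_integral_insert_rev[OF finite_atLeastAtMost notin f, unfolded I[symmetric]])
  also have "\<dots> = (\<integral>\<^sup>+ y. height_sum k (x - y) \<partial>descending_law)"
  proof (intro nn_integral_cong)
    fix y
    have "(\<integral>\<^sup>+ \<zeta>. ?f (\<zeta>(Suc k := y)) \<partial>(\<Pi>\<^sub>M i\<in>{1..k}. descending_law)) =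
        (\<integral>\<^sup>+ \<zeta>. indicator (?E k (x - y)) \<zeta> \<partial>(\<Pi>\<^sub>M i\<in>{1..k}. descending_law))"
    proof (intro nn_integral_cong)
      fix \<zeta> assume z: "\<zeta> \<in> space (\<Pi>\<^sub>M i\<in>{1..k}. descending_law)"
      have sp: "\<zeta>(Suc k := y) \<in> space (\<Pi>\<^sub>M i\<in>{1..Suc k}. descending_law)"
        using z unfolding I space_PiM by (intro PiE_fun_upd) (simp_all add: descending_law_def)
      have "(\<Sum>i=1..k. (\<zeta>(Suc k := y)) i) = (\<Sum>i=1..k. \<zeta> i)"
        by (intro sum.cong) auto
      then have sum: "(\<Sum>i=1..Suc k. (\<zeta>(Suc k := y)) i) = (\<Sum>i=1..k. \<zeta> i) + y"
        by (simp del: fun_upd_apply) simp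
      show "?f (\<zeta>(Suc k := y)) = indicator (?E k (x - y)) \<zeta>"
        using z sp unfolding indicator_def mem_Collect_eq sum by (simp add: le_diff_eq)
    qed
    then show "(\<integral>\<^sup>+ \<zeta>. ?f (\<zeta>(Suc k := y)) \<partial>(\<Pi>\<^sub>M i\<in>{1..k}. descending_law)) = height_sum k (x - y)"
      unfolding height_sum_def using S[of k "x - y"] by simp
  qed
  also have "\<dots> = exit_mean {1..} (\<lambda>y. height_sum k (x + y)) 0"
    unfolding nn_integral_descending_law by simp
  finally show ?thesis .
qed

text \<open>Partial sums stay below \<open>green\<close> by \<open>green_renewal_ge\<close>, and the
  full series is a supersolution, so \<open>green_least\<close> gives the converse. The shift by 1
  is that between \<open>\<le> x\<close> and \<open>< x + 1\<close>.\<close>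

lemma suminf_height_sum: "(\<Sum>k. height_sum k x) = green (x + 1)"
proof (rule antisym)
  have partial: "(\<Sum>k<Suc n. height_sum k x) =
      (if 0 \<le> x then 1 else 0) + exit_mean {1..} (\<lambda>y. \<Sum>k<n. height_sum k (x + y)) 0" for n x
    unfolding sum.lessThan_Suc_shift by (simp add: height_sum_0 height_sum_Suc exit_mean_sum)
  have "(\<Sum>k<n. height_sum k x) \<le> green (x + 1)" for n x
  proof (induction n arbitrary: x)
    case (Suc n)
    have "(\<Sum>k<Suc n. height_sum k x) \<le>
      (if 0 < x + 1 then 1 else 0) + exit_mean {1..} (\<lambda>y. green (x + 1 + y)) 0"
      unfolding partial
      using Suc.IH[of "x + _"] by (intro add_mono exit_mean_mono) (auto simp: add_ac)
    also have "\<dots> \<le> green (x + 1)" by (rule green_renewal_ge)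
    finally show ?case .
  qed simp
  then show "(\<Sum>k. height_sum k x) \<le> green (x + 1)"
    unfolding suminf_eq_SUP by (intro SUP_least)
  have "green z \<le> (\<Sum>k. height_sum k (z - 1))" for z
  proof (rule green_least)
    fix x
    have "exit_mean {1..} (\<lambda>y. \<Sum>k. height_sum k (x + y - 1)) 0 =
        (SUP n. exit_mean {1..} (\<lambda>y. \<Sum>k<n. height_sum k (x - 1 + y)) 0)"
      unfolding suminf_eq_SUP
      by (subst exit_mean_SUP_fun) (auto simp: incseq_def algebra_simps intro!: sum_mono2)
    then have "(if 0 < x then 1 else 0) + exit_mean {1..} (\<lambda>y. \<Sum>k. height_sum k (x + y - 1)) 0 =
        (SUP n. (if 0 \<le> x - 1 then 1 else 0) + exit_mean {1..} (\<lambda>y. \<Sum>k<n. height_sum k (x - 1 + y)) 0)"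
      by (subst ennreal_SUP_add_right[symmetric])
        (auto simp: incseq_def intro!: exit_mean_mono sum_mono2)
    also have "\<dots> = (SUP n. \<Sum>k<Suc n. height_sum k (x - 1))"
      by (simp only: partial)
    also have "\<dots> \<le> (\<Sum>k. height_sum k (x - 1))"
      unfolding suminf_eq_SUP by (rule SUP_least, rule SUP_upper) simp
    finally show "(if 0 < x then 1 else 0) + exit_mean {1..} (\<lambda>y. \<Sum>k. height_sum k (x + y - 1)) 0
      \<le> (\<Sum>k. height_sum k (x - 1))" .
  qed
  from this[of "x + 1"] show "green (x + 1) \<le> (\<Sum>k. height_sum k x)" by simp
qed

lemma V_ds_eq:
  assumes "0 \<le> x"
  shows "V_ds M X x = harm (x + 1)"
proof -
  define P where "P k = enn2real (height_sum k x)" for k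
  have hs: "height_sum k x = ennreal (P k)" for k
  proof -
    interpret P: prob_space "\<Pi>\<^sub>M i\<in>{1..k}. descending_law"
      by (rule prob_space_PiM) (rule D.prob_space_axioms)
    show ?thesis unfolding P_def height_sum_def by (simp only: P.emeasure_eq_measure enn2real_ennreal measure_nonneg)
  qed
  have P0: "0 \<le> P k" for k by (simp add: P_def)
  have sum: "(\<Sum>k. ennreal (P k)) = green (x + 1)"
    using suminf_height_sum[of x] by (simp add: hs)
  then have "summable P"
    using P0 green_finite[of "x + 1"] by (intro summable_suminf_not_top) (auto simp: less_top)
  then have "ennreal (suminf P) = green (x + 1)"
    using sum P0 by (simp add: suminf_ennreal2)
  then have "suminf P = harm (x + 1)"
    using assms harm_nonneg[of "x + 1"] suminf_nonneg[OF \<open>summable P\<close> P0] by (simp add: green_harm)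
  moreover have "suminf P = P 0 + (\<Sum>k. P (Suc k))"
    using suminf_split_head[OF \<open>summable P\<close>] by simp
  moreover have "P 0 = 1" using assms by (simp add: P_def height_sum_0)
  ultimately show ?thesis
    by (simp add: V_ds_def P_def height_sum_def measure_def descending_law_def)
qed

lemma f_r_eq: "0 \<le> x \<Longrightarrow> f_r M X x = harm x"
  using V_ds_eq[of "x - 1"] prob_strict_ascending_height_pos
  by (cases "x = 0") (auto simp: f_r_def harm_zero)

lemma prob_below:
  "prob {\<omega> \<in> space M. hitting_time {..0} (walk X x \<omega>) < hitting_time {R..} (walk X x \<omega>)} =
    enn2real (hit_below x R)" if "0 < R"
  using that unfolding hit_below_def
  by (subst prob_hitting_time_less[where A = "{1..<R}"]) auto

lemma prob_zero:
  "prob {\<omega> \<in> space M. hitting_time {0} (walk X x \<omega>) < hitting_time {R..} (walk X x \<omega>)} =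
    enn2real (hit_zero x R)" if "0 < R"
  using that unfolding hit_zero_def
  by (subst prob_hitting_time_less[where A = "{..<R} - {0}"]) auto

end

section \<open>Passage to the limit\<close>

lemma eventually_gap_at_top:
  "eventually P gap_at_top \<longleftrightarrow> (\<exists>r. \<forall>x R. 0 \<le> x \<and> x < R \<and> r \<le> R - x \<longrightarrow> P (x, R))"
  unfolding gap_at_top_def eventually_inf_principal eventually_filtercomap_at_top_linorder
  by (auto simp: imp_conjL)

theorem proposition2:
  fixes M :: "'a measure" and X :: "nat \<Rightarrow> 'a \<Rightarrow> int"
  assumes "prob_space M"
    and "iid_steps M X"
    and "irreducible_walk M X"
    and "recurrent_walk M X"
    and "integrable M (\<lambda>\<omega>. real_of_int (strict_ascending_height X \<omega>))"
  shows "((\<lambda>(x, R).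
            \<P>(\<omega> in M. hitting_time {0} (walk X x \<omega>) < hitting_time {R..} (walk X x \<omega>)) /
            \<P>(\<omega> in M. hitting_time {..0} (walk X x \<omega>) < hitting_time {R..} (walk X x \<omega>)))
          \<longlongrightarrow> 1) gap_at_top
       \<and> ((\<lambda>(x, R).
            \<P>(\<omega> in M. hitting_time {..0} (walk X x \<omega>) < hitting_time {R..} (walk X x \<omega>)) /
            ((f_r M X R - f_r M X x) / f_r M X R))
          \<longlongrightarrow> 1) gap_at_top
       \<and> (\<forall>x R. 0 \<le> x \<and> x < R \<longrightarrow>
            (f_r M X R - f_r M X x) / f_r M X R \<le> f_r M X (R - x) / f_r M X R)"
proof -
  interpret finite_mean_iid_walk M X
    using assms by (intro finite_mean_iid_walk.intro iid_walk.intro iid_walk_axioms.intro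
      finite_mean_iid_walk_axioms.intro)
  show ?thesis
  proof (intro conjI allI impI)
    show "((\<lambda>(x, R).
            \<P>(\<omega> in M. hitting_time {0} (walk X x \<omega>) < hitting_time {R..} (walk X x \<omega>)) /
            \<P>(\<omega> in M. hitting_time {..0} (walk X x \<omega>) < hitting_time {R..} (walk X x \<omega>)))
          \<longlongrightarrow> 1) gap_at_top"
    proof (rule tendstoI)
      fix e :: real assume "0 < e"
      then obtain S where S: "\<And>R x. S \<le> R \<Longrightarrow> hit_zero x R \<le> hit_below x R \<and>
          hit_below x R \<le> hit_zero x R + ennreal (e / 2) * hit_below x R"
        using hit_zero_asymptotics[of "e / 2"] by auto
      \<comment> \<open>As \<open>0 \<le> x\<close>, a gap of at least \<open>S\<close> forces
        \<open>S \<le> R\<close>.\<close>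
      have "dist (enn2real (hit_zero x R) / enn2real (hit_below x R)) 1 < e"
        if x: "0 \<le> x" "x < R" "S \<le> R - x" for x R
      proof -
        obtain a where a: "hit_below x R = ennreal a" "0 \<le> a"
          using hit_below_le_1[of x R] by (cases "hit_below x R") (auto simp: top_unique)
        obtain b where b: "hit_zero x R = ennreal b" "0 \<le> b"
          using hit_zero_le_1[of x R] by (cases "hit_zero x R") (auto simp: top_unique)
        have a0: "0 < a" using hit_below_pos[OF x(1,2)] a by simp
        have "b \<le> a" using S[of R x] x a b by simp
        moreover have "ennreal a \<le> ennreal (b + e / 2 * a)"
          using S[of R x] x a b \<open>0 < e\<close> by (simp add: ennreal_mult[symmetric])
        then have "a \<le> b + e / 2 * a"
          using a b \<open>0 < e\<close> by (subst (asm) ennreal_le_iff) auto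
        ultimately have "1 - e / 2 \<le> b / a" "b / a \<le> 1"
          using a0 by (auto simp: field_simps)
        then show ?thesis using a b \<open>0 < e\<close> by (simp add: dist_real_def)
      qed
      then show "\<forall>\<^sub>F z in gap_at_top. dist (case z of (x, R) \<Rightarrow>
            \<P>(\<omega> in M. hitting_time {0} (walk X x \<omega>) < hitting_time {R..} (walk X x \<omega>)) /
            \<P>(\<omega> in M. hitting_time {..0} (walk X x \<omega>) < hitting_time {R..} (walk X x \<omega>))) 1 < e"
        unfolding eventually_gap_at_top by (intro exI[of _ S]) (simp add: prob_below prob_zero)
    qed
    show "((\<lambda>(x, R).
            \<P>(\<omega> in M. hitting_time {..0} (walk X x \<omega>) < hitting_time {R..} (walk X x \<omega>)) /
            ((f_r M X R - f_r M X x) / f_r M X R))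
          \<longlongrightarrow> 1) gap_at_top"
    proof (rule tendstoI)
      fix e :: real assume "0 < e"
      then obtain r where r: "\<And>x R. 0 \<le> x \<Longrightarrow> x < R \<Longrightarrow> r \<le> R - x \<Longrightarrow> harm x < harm R \<and>
          harm R - harm x \<le> harm R * enn2real (hit_below x R) \<and>
          harm R * enn2real (hit_below x R) \<le> (1 + e / 2) * (harm R - harm x)"
        using hit_below_asymptotics[of "e / 2"] by auto
      have "dist (enn2real (hit_below x R) / ((harm R - harm x) / harm R)) 1 < e"
        if x: "0 \<le> x" "x < R" "r \<le> R - x" for x R
      proof -
        define q where "q = harm R * enn2real (hit_below x R) / (harm R - harm x)"
        have "1 \<le> q" "q \<le> 1 + e / 2"
          using r[OF x] by (auto simp: q_def pos_le_divide_eq pos_divide_le_eq)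
        moreover have "enn2real (hit_below x R) / ((harm R - harm x) / harm R) = q"
          by (simp add: q_def)
        ultimately show ?thesis using \<open>0 < e\<close> by (simp add: dist_real_def)
      qed
      then show "\<forall>\<^sub>F z in gap_at_top. dist (case z of (x, R) \<Rightarrow>
            \<P>(\<omega> in M. hitting_time {..0} (walk X x \<omega>) < hitting_time {R..} (walk X x \<omega>)) /
            ((f_r M X R - f_r M X x) / f_r M X R)) 1 < e"
        unfolding eventually_gap_at_top by (intro exI[of _ r]) (simp add: prob_below f_r_eq)
    qed
  next
    fix x R :: int assume x: "0 \<le> x \<and> x < R"
    \<comment> \<open>Subadditivity is for positive arguments; at \<open>x = 0\<close> the left side
      is \<open>harm R - 1\<close>.\<close>
    have "harm R - harm x \<le> harm (R - x)"
      using harm_subadditive[of x "R - x"] x by (cases "x = 0") (auto simp: harm_zero)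
    then show "(f_r M X R - f_r M X x) / f_r M X R \<le> f_r M X (R - x) / f_r M X R"
      using x harm_nonneg[of R] by (simp add: f_r_eq divide_right_mono)
  qed
qed

end
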